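(* Let $K(\lambda)$ be a solution of the dual reflection equation $$R_{12}(-\lambda_1+\lambda_2)\,K_1(\lambda_1)\,M_1^{-1}R_{21}(-\lambda_1-\lambda_2-2\rho)M_1\,K_2(\lambda_2)=K_2(\lambda_2)\,M_1R_{12}(-\lambda_1-\lambda_2-2\rho)M_1^{-1}\,K_1(\lambda_1)\,R_{21}(-\lambda_1+\lambda_2),$$ where $K(\lambda)\in\mathrm{End}(V)$ has operator entries acting on a quantum space. For every ordered set $\mathcal N=\langle1,2,\dots,n\rangle$ of labels put $$\mathcal K^0_{\mathcal N}(\lambda_{\mathcal N})=K_n\,M_{n-1}R_{n-1,n}(-\lambda_n-\lambda_{n-1}-2\rho)M_{n-1}^{-1}\,K_{n-1}\cdots K_{k+1}\,M_kR_{kn}(-\lambda_k-\lambda_n-2\rho)\cdots R_{k,k+1}(-\lambda_k-\lambda_{k+1}-2\rho)M_k^{-1}\,K_k\cdots K_2\,M_1R_{1n}(-\lambda_1-\lambda_n-2\rho)\cdots R_{12}(-\lambda_1-\lambda_2-2\rho)M_1^{-1}\,K_1,$$ with $K_i=K_i(\lambda_i)$. Then the objects $\mathcal K^0_{\mathcal N}$ satisfy the generalized dual reflection equations: for all disjoint ordered sets of labels $\mathcal N=\langle1,\dots,n\rangle$ and $\mathcal M'=\langle1',\dots,m'\rangle$, $$\mathcal K^0_{\mathcal N}(\lambda_{\mathcal N})\,M_{\mathcal M'}R_{\bar{\mathcal M}'\bar{\mathcal N}}(-\lambda_{\bar{\mathcal N}}-\lambda_{\bar{\mathcal M}'}-2\rho)M_{\mathcal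 M'}^{-1}\,\mathcal K^0_{\mathcal M'}(\lambda_{\mathcal M'})\,R_{\mathcal N\bar{\mathcal M}'}(\lambda_{\mathcal N}-\lambda_{\bar{\mathcal M}'})$$ $$=R_{\bar{\mathcal M}'\mathcal N}(\lambda_{\mathcal N}-\lambda_{\bar{\mathcal M}'})\,\mathcal K^0_{\mathcal M'}(\lambda_{\mathcal M'})\,M_{\mathcal M'}^{-1}R_{\bar{\mathcal N}\bar{\mathcal M}'}(-\lambda_{\bar{\mathcal N}}-\lambda_{\bar{\mathcal M}'}-2\rho)M_{\mathcal M'}\,\mathcal K^0_{\mathcal N}(\lambda_{\mathcal N}).$$
   Context: $V$ is a finite-dimensional complex vector space (auxiliary space); $V_i$ denotes a copy of $V$ labelled by $i$, and subscripts indicate the copies on which an operator acts. To each label $i$ is attached a spectral parameter $\lambda_i\in\mathbb C$. All identities hold for generic values of the parameters (as identities of matrix-valued functions). $R(\lambda)\in\mathrm{End}(V\otimes V)$ is a c-number matrix, $R_{21}=P_{12}R_{12}P_{12}$ with $P_{12}$ the permutation of the two factors, and $t_i$ denotes transposition in the space $V_i$. Standing assumptions on $R$: (I) Yang--Baxter equation: $R_{12}(\lambda_1-\lambda_2)R_{13}(\lambda_1)R_{23}(\lambda_2)=R_{23}(\lambda_2)R_{13}(\lambda_1)R_{12}(\lambda_1-\lambda_2)$. (II) $R_{12}(\lambda)=R_{21}(\lambda)^{t_1t_2}$. (III) Unitarity $R_{12}(\lambda)R_{21}(-\lambda)\propto 1$; crossing $R_{12}(\lambda)=V_1R_{12}^{t_2}(-\lambda-\rho)V_1=V_2^{t_2}R_{12}^{t_1}(-\lambda-\rho)V_2^{t_2}$;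 crossing-unitarity $R_{21}(\lambda)^{t_1}M_1^{-1}R_{12}(-\lambda-2\rho)^{t_1}M_1\propto 1$; and $[R_{12}(\lambda),M_1M_2]=0$. Here (in these crossing formulas only) $V_i$ denotes a c-number matrix $V$ with $V^2=1$ acting on the $i$-th space, $M=V^tV$, and $\rho$ is a fixed constant. The sign $\propto$ means equality up to a nonzero scalar function. For an ordered set of labels $\mathcal X=\langle x_1,\dots,x_a\rangle$, $M_{\mathcal X}=M_{x_1}\cdots M_{x_a}$. Fused $R$-matrices: for disjoint ordered sets of labels $\mathcal X=\langle x_1,\dots,x_a\rangle$ and $\mathcal Y=\langle y_1,\dots,y_b\rangle$, $$R_{\mathcal X\mathcal Y}=\big(R_{x_1y_1}R_{x_2y_1}\cdots R_{x_ay_1}\big)\big(R_{x_1y_2}\cdots R_{x_ay_2}\big)\cdots\big(R_{x_1y_b}\cdots R_{x_ay_b}\big).$$ An argument such as $\epsilon\lambda_{\mathcal X}+\epsilon'\lambda_{\mathcal Y}+c$ means that each factor $R_{xy}$ is evaluated at $\epsilon\lambda_x+\epsilon'\lambda_y+c$. For an ordered set $\mathcal N=\langle 1,\dots,n\rangle$, $\bar{\mathcal N}=\langle n,n-1,\dots,1\rangle$ is the set in reversed order. $K_i(\lambda_i)$ is the matrix $K(\lambda_i)$ acting on the auxiliary space $V_i$, whose entries are (in general noncommuting) operators on one and the same quantum space, possibly including an additional boundary quantum space. The quantum labels are omitted. $\mathcal K^0_{\mathcal M'}$ is given by the same formula as $\mathcal K^0_{\mathcal N}$ with labels $1',\dots,m'$;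 for $n=1$, $\mathcal K^0_{\langle1\rangle}=K_1(\lambda_1)$. *)

theory Defs
  imports "HOL-Analysis.Analysis"
begin

text \<open>
  The auxiliary space is \<open>V = \<complex>\<^sup>d\<close> with basis indexed by \<open>'d\<close>, so a c-number operator on \<open>V\<close> is
  a matrix indexed by \<open>'d\<close> and one on \<open>V \<otimes> V\<close> is a matrix indexed by \<open>'d \<times> 'd\<close>.
\<close>

type_synonym 'd mat1 = "complex ^ 'd ^ 'd"
type_synonym 'd mat2 = "complex ^ ('d \<times> 'd) ^ ('d \<times> 'd)"

text \<open>
  Matrix-valued functions of spectral parameters are modelled by total functions whose values at
  singular points are irrelevant: an identity holds for generic parameters if it holds on an open
  dense set of parameters.
\<close>

definition generic :: "('a::topological_space \<Rightarrow> bool) \<Rightarrow> bool" where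
  "generic P \<longleftrightarrow> (\<exists>U. open U \<and> closure U = UNIV \<and> (\<forall>x\<in>U. P x))"


definition tensor :: "'d::finite mat1 \<Rightarrow> 'd mat1 \<Rightarrow> 'd mat2" where
  "tensor A B = (\<chi> p q. A $ fst p $ fst q * B $ snd p $ snd q)"

definition perm_mat :: "'d::finite mat2" where
  "perm_mat = (\<chi> p q. if fst p = snd q \<and> snd p = fst q then 1 else 0)"

definition swap21 :: "'d::finite mat2 \<Rightarrow> 'd mat2" where
  "swap21 A = perm_mat ** A ** perm_mat"

definition transp1 :: "'d::finite mat2 \<Rightarrow> 'd mat2" where
  "transp1 A = (\<chi> p q. A $ (fst q, snd p) $ (fst p, snd q))"

definition transp2 :: "'d::finite mat2 \<Rightarrow> 'd mat2" where
  "transp2 A = (\<chi> p q. A $ (fst p, snd q) $ (fst q, snd p))"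


text \<open>
  Let \<open>'l\<close> be a finite type of labels and let \<open>'h\<close> be the quantum space, a complex vector space
  with scalar multiplication \<open>sc\<close>. A vector of \<open>(\<Otimes>i. V\<^sub>i) \<otimes> 'h\<close> is given by its components, which
  are vectors of \<open>'h\<close> indexed by multi-indices \<open>'l \<Rightarrow> 'd\<close>. In \<open>site2 sc i j A\<close> the first tensor factor
  of \<open>A\<close> acts on \<open>V\<^sub>i\<close> and the second one on \<open>V\<^sub>j\<close>, so that \<open>site2 sc 2 1 A\<close> is the operator
  \<open>A\<^sub>2\<^sub>1 = P\<^sub>1\<^sub>2 A\<^sub>1\<^sub>2 P\<^sub>1\<^sub>2\<close>. The product of operators is composition.
\<close>

type_synonym ('l, 'd, 'h) op = "(('l \<Rightarrow> 'd) \<Rightarrow> 'h) \<Rightarrow> (('l \<Rightarrow> 'd) \<Rightarrow> 'h)"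

definition site1 ::
  "(complex \<Rightarrow> 'h \<Rightarrow> 'h::ab_group_add) \<Rightarrow> 'l::finite \<Rightarrow> 'd::finite mat1 \<Rightarrow> ('l, 'd, 'h) op" where
  "site1 sc i A \<psi> = (\<lambda>s. \<Sum>a\<in>UNIV. sc (A $ s i $ a) (\<psi> (s(i := a))))"

definition site2 ::
  "(complex \<Rightarrow> 'h \<Rightarrow> 'h::ab_group_add) \<Rightarrow> 'l::finite \<Rightarrow> 'l \<Rightarrow> 'd::finite mat2 \<Rightarrow> ('l, 'd, 'h) op" where
  "site2 sc i j A \<psi> =
     (\<lambda>s. \<Sum>a\<in>UNIV. \<Sum>b\<in>UNIV. sc (A $ (s i, s j) $ (a, b)) (\<psi> (s(i := a, j := b))))"

definition siteq ::
  "'l::finite \<Rightarrow> ('h \<Rightarrow> 'h::ab_group_add) ^ 'd::finite ^ 'd \<Rightarrow> ('l, 'd, 'h) op" where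
  "siteq i K \<psi> = (\<lambda>s. \<Sum>a\<in>UNIV. (K $ s i $ a) (\<psi> (s(i := a))))"

definition oprod :: "('a \<Rightarrow> 'a) list \<Rightarrow> 'a \<Rightarrow> 'a" where
  "oprod fs = foldr (\<circ>) fs id"


text \<open>
  In the numeral type \<open>3\<close> we have \<open>3 = 0\<close>, so \<open>1, 2, 3\<close> are its three distinct elements; likewise
  \<open>1, 2\<close> are the two distinct elements of the type \<open>2\<close>.
\<close>

definition yang_baxter :: "(complex \<Rightarrow> 'd::finite mat2) \<Rightarrow> bool" where
  "yang_baxter R \<longleftrightarrow> generic (\<lambda>(l1, l2).
     (let R12 = (site2 (*) (1::3) 2 (R (l1 - l2)) :: (3, 'd, complex) op);
          R13 = site2 (*) 1 3 (R l1);
          R23 = site2 (*) 2 3 (R l2)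
      in R12 \<circ> R13 \<circ> R23 = R23 \<circ> R13 \<circ> R12))"

definition pt_symmetric :: "(complex \<Rightarrow> 'd::finite mat2) \<Rightarrow> bool" where
  "pt_symmetric R \<longleftrightarrow> generic (\<lambda>l. R l = transp1 (transp2 (swap21 (R l))))"

definition unitarity :: "(complex \<Rightarrow> 'd::finite mat2) \<Rightarrow> bool" where
  "unitarity R \<longleftrightarrow> generic (\<lambda>l. \<exists>c. c \<noteq> 0 \<and> R l ** swap21 (R (- l)) = mat c)"

definition crossing :: "(complex \<Rightarrow> 'd::finite mat2) \<Rightarrow> 'd mat1 \<Rightarrow> complex \<Rightarrow> bool" where
  "crossing R V \<rho> \<longleftrightarrow> generic (\<lambda>l.
     R l = tensor V (mat 1) ** transp2 (R (- l - \<rho>)) ** tensor V (mat 1) \<and>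
     R l = tensor (mat 1) (transpose V) ** transp1 (R (- l - \<rho>)) ** tensor (mat 1) (transpose V))"

definition crossing_unitarity ::
  "(complex \<Rightarrow> 'd::finite mat2) \<Rightarrow> 'd mat1 \<Rightarrow> complex \<Rightarrow> bool" where
  "crossing_unitarity R M \<rho> \<longleftrightarrow> generic (\<lambda>l. \<exists>c. c \<noteq> 0 \<and>
     transp1 (swap21 (R l)) ** tensor (matrix_inv M) (mat 1) **
     transp1 (R (- l - 2 * \<rho>)) ** tensor M (mat 1) = mat c)"

definition commutes_MM :: "(complex \<Rightarrow> 'd::finite mat2) \<Rightarrow> 'd mat1 \<Rightarrow> bool" where
  "commutes_MM R M \<longleftrightarrow> generic (\<lambda>l. R l ** tensor M M = tensor M M ** R l)"


definition dual_reflection ::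
  "(complex \<Rightarrow> 'h \<Rightarrow> 'h::ab_group_add) \<Rightarrow> (complex \<Rightarrow> 'd::finite mat2) \<Rightarrow> 'd mat1 \<Rightarrow> complex \<Rightarrow>
     (complex \<Rightarrow> ('h \<Rightarrow> 'h) ^ 'd ^ 'd) \<Rightarrow> bool" where
  "dual_reflection sc R M \<rho> K \<longleftrightarrow> generic (\<lambda>(l1, l2).
     (let K1 = (siteq (1::2) (K l1) :: (2, 'd, 'h) op);
          K2 = siteq 2 (K l2);
          M1 = site1 sc 1 M;
          M1inv = site1 sc 1 (matrix_inv M);
          R12 = (\<lambda>u. site2 sc 1 2 (R u));
          R21 = (\<lambda>u. site2 sc 2 1 (R u))
      in R12 (- l1 + l2) \<circ> K1 \<circ> M1inv \<circ> R21 (- l1 - l2 - 2 * \<rho>) \<circ> M1 \<circ> K2 =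
         K2 \<circ> M1 \<circ> R12 (- l1 - l2 - 2 * \<rho>) \<circ> M1inv \<circ> K1 \<circ> R21 (- l1 + l2)))"


text \<open>
  Ordered sets of labels are lists without repetitions. In \<open>fusedR sc R u X Y\<close> the factor labelled
  \<open>(x, y)\<close> is evaluated at \<open>u x y\<close>.
\<close>

definition fusedR ::
  "(complex \<Rightarrow> 'h \<Rightarrow> 'h::ab_group_add) \<Rightarrow> (complex \<Rightarrow> 'd::finite mat2) \<Rightarrow>
     ('l::finite \<Rightarrow> 'l \<Rightarrow> complex) \<Rightarrow> 'l list \<Rightarrow> 'l list \<Rightarrow> ('l, 'd, 'h) op" where
  "fusedR sc R u X Y = oprod [site2 sc x y (R (u x y)). y \<leftarrow> Y, x \<leftarrow> X]"

definition siteM ::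
  "(complex \<Rightarrow> 'h \<Rightarrow> 'h::ab_group_add) \<Rightarrow> 'd::finite mat1 \<Rightarrow> 'l::finite list \<Rightarrow> ('l, 'd, 'h) op" where
  "siteM sc M X = oprod (map (\<lambda>x. site1 sc x M) X)"

text \<open>
  The dressed operator of \<open>\<langle>1, \<dots>, n\<rangle>\<close> arises from that of \<open>\<langle>2, \<dots>, n\<rangle>\<close> by multiplying on the right
  by \<open>M\<^sub>1 R\<^sub>1\<^sub>n \<dots> R\<^sub>1\<^sub>2 M\<^sub>1\<inverse> K\<^sub>1\<close>.
\<close>

fun K0 ::
  "(complex \<Rightarrow> 'h \<Rightarrow> 'h::ab_group_add) \<Rightarrow> (complex \<Rightarrow> 'd::finite mat2) \<Rightarrow> 'd mat1 \<Rightarrow> complex \<Rightarrow>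
     (complex \<Rightarrow> ('h \<Rightarrow> 'h) ^ 'd ^ 'd) \<Rightarrow> complex ^ 'l::finite \<Rightarrow> 'l list \<Rightarrow> ('l, 'd, 'h) op" where
  "K0 sc R M \<rho> K l [] = id"
| "K0 sc R M \<rho> K l [x] = siteq x (K (l $ x))"
| "K0 sc R M \<rho> K l (x # y # ys) =
     K0 sc R M \<rho> K l (y # ys) \<circ>
     site1 sc x M \<circ>
     oprod (map (\<lambda>z. site2 sc x z (R (- (l $ x) - l $ z - 2 * \<rho>))) (rev (y # ys))) \<circ>
     site1 sc x (matrix_inv M) \<circ>
     siteq x (K (l $ x))"

end

theory Submission
  imports Defs
begin

text \<open>
  Write \<open>A\<^sub>x\<^sub>y = M\<^sub>x R\<^sub>x\<^sub>y(-\<lambda>\<^sub>x - \<lambda>\<^sub>y - 2\<rho>) M\<^sub>x\<inverse>\<close>, \<open>D\<^sub>x\<^sub>y = R\<^sub>x\<^sub>y(\<lambda>\<^sub>y - \<lambda>\<^sub>x)\<close> and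
  \<open>E\<^sub>x\<^sub>y = R\<^sub>x\<^sub>y(\<lambda>\<^sub>x - \<lambda>\<^sub>y)\<close>. Since \<open>R\<close> commutes with \<open>M\<^sub>x M\<^sub>y\<close>, also
  \<open>A\<^sub>x\<^sub>y = M\<^sub>y\<inverse> R\<^sub>x\<^sub>y M\<^sub>y\<close>. In these terms all occurrences of \<open>M\<close> disappear and the claim reads
  \<open>\<K>\<^sub>N A\<^bsub>rev P, rev N\<^esub> \<K>\<^sub>P E\<^bsub>N, rev P\<^esub> = D\<^bsub>rev P, N\<^esub> \<K>\<^sub>P A\<^bsub>rev N, rev P\<^esub> \<K>\<^sub>N\<close>, where
  \<open>\<K>\<^bsub>x # ys\<^esub> = \<K>\<^bsub>ys\<^esub> A\<^bsub>[x], rev ys\<^esub> K\<^sub>x\<close>.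

  Three relations between different labels suffice. The first two are the Yang--Baxter equation at
  two choices of its arguments; conjugating it by a one-site matrix at the label shared by both
  \<open>A\<close>'s replaces \<open>R\<close> by \<open>A\<close>. The third one is the dual reflection equation.
  \<^item> \<open>D\<^sub>x\<^sub>y A\<^sub>x\<^sub>z A\<^sub>y\<^sub>z = A\<^sub>y\<^sub>z A\<^sub>x\<^sub>z D\<^sub>x\<^sub>y\<close>
  \<^item> \<open>A\<^sub>x\<^sub>y A\<^sub>x\<^sub>z E\<^sub>y\<^sub>z = E\<^sub>y\<^sub>z A\<^sub>x\<^sub>z A\<^sub>x\<^sub>y\<close>
  \<^item> \<open>D\<^sub>x\<^sub>y K\<^sub>x A\<^sub>y\<^sub>x K\<^sub>y = K\<^sub>y A\<^sub>x\<^sub>y K\<^sub>x E\<^sub>y\<^sub>x\<close>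

  The operators \<open>K\<^sub>x\<close> and \<open>K\<^sub>y\<close> need not commute, because their entries act on the same quantum
  space; everything else commutes as soon as the sets of labels are disjoint. The two
  Yang--Baxter relations extend to ordered products by induction on the lists (lemmas
  \<open>DAA_fused\<close> and \<open>AAE_fused\<close>). With them, the claim follows by induction on \<open>N\<close> if \<open>P\<close> consists
  of one label (\<open>reflection_single\<close>), and then by induction on \<open>P\<close> for every \<open>N\<close>
  (\<open>generalized_reflection\<close>).

  Two matters remain. The hypotheses concern operators on two or three copies of \<open>V\<close>; they are
  carried over to arbitrary labels by freezing the components of a multi-index at all other labels,
  and, for the Yang--Baxter equation, by testing with linear functionals on the quantum space.
  And they hold only generically: each is used at finitely many points, which are surjective affine
  functions of the parameters \<open>\<lambda>\<close>. Preimages of open dense sets under such functions and finite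
  intersections of open dense sets are open and dense.
\<close>

section \<open>Operators on tensor products\<close>

lemma linear_map_sum:
  "Vector_Spaces.linear s1 s2 f \<Longrightarrow> f (\<Sum>i\<in>I. g i) = (\<Sum>i\<in>I. f (g i))"
  by (simp add: linear_iff_module_hom module_hom.sum)

lemma linear_map_scale:
  "Vector_Spaces.linear s1 s2 f \<Longrightarrow> f (s1 c v) = s2 c (f v)"
  by (simp add: linear_iff_module_hom module_hom.scale)

locale complex_space = vector_space sc
  for sc :: "complex \<Rightarrow> 'h \<Rightarrow> 'h::ab_group_add"
begin

lemma site1_site1_commute:
  assumes "x \<noteq> y"
  shows "site1 sc x A \<circ> site1 sc y B = site1 sc y B \<circ> site1 sc x A"
  using assms
  by (auto simp: site1_def fun_eq_iff scale_sum_right fun_upd_twist mult.commute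
      intro: sum.swap[THEN trans] sum.cong)

text \<open>
  A single sum over pairs turns each commutation proof below into one exchange of two summations.
\<close>

lemma site2_eq_sum_pairs:
  "site2 sc x y B \<psi> s = (\<Sum>p\<in>UNIV. sc (B $ (s x, s y) $ p) (\<psi> (s(x := fst p, y := snd p))))"
  by (simp add: site2_def sum.cartesian_product UNIV_Times_UNIV[symmetric] split_def del: UNIV_Times_UNIV)

lemma site1_site2_commute:
  fixes z :: "'l::finite" and B :: "'d::finite mat2"
  assumes "z \<notin> {x, y}"
  shows "site1 sc z A \<circ> site2 sc x y B = site2 sc x y B \<circ> site1 sc z A"
proof (intro ext)
  fix \<psi> and s :: "'l \<Rightarrow> 'd"
  have ne: "z \<noteq> x" "x \<noteq> z" "z \<noteq> y" "y \<noteq> z"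
    using assms by auto
  have upd: "s(z := c, x := a, y := b) = s(x := a, y := b, z := c)" for a b c
    using ne by (auto simp: fun_eq_iff)
  have "(site1 sc z A \<circ> site2 sc x y B) \<psi> s = (\<Sum>c\<in>UNIV. \<Sum>p\<in>UNIV.
        sc (A $ s z $ c * B $ (s x, s y) $ p) (\<psi> (s(x := fst p, y := snd p, z := c))))"
    using ne by (simp add: site1_def site2_eq_sum_pairs scale_sum_right upd)
  also have "\<dots> = (\<Sum>p\<in>UNIV. \<Sum>c\<in>UNIV.
        sc (A $ s z $ c * B $ (s x, s y) $ p) (\<psi> (s(x := fst p, y := snd p, z := c))))"
    by (rule sum.swap)
  also have "\<dots> = (site2 sc x y B \<circ> site1 sc z A) \<psi> s"
    using ne by (simp add: site1_def site2_eq_sum_pairs scale_sum_right mult.commute)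
  finally show "(site1 sc z A \<circ> site2 sc x y B) \<psi> s = (site2 sc x y B \<circ> site1 sc z A) \<psi> s" .
qed

lemma site2_site2_commute:
  fixes x :: "'l::finite" and A :: "'d::finite mat2"
  assumes "{x, y} \<inter> {z, w} = {}"
  shows "site2 sc x y A \<circ> site2 sc z w B = site2 sc z w B \<circ> site2 sc x y A"
proof (intro ext)
  fix \<psi> and s :: "'l \<Rightarrow> 'd"
  have ne: "x \<noteq> z" "x \<noteq> w" "y \<noteq> z" "y \<noteq> w" "z \<noteq> x" "w \<noteq> x" "z \<noteq> y" "w \<noteq> y"
    using assms by auto
  have upd: "s(x := a, y := b, z := c, w := d) = s(z := c, w := d, x := a, y := b)" for a b c d
    using ne by (auto simp: fun_eq_iff)
  have "(site2 sc x y A \<circ> site2 sc z w B) \<psi> s =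
      (\<Sum>p\<in>UNIV. \<Sum>q\<in>UNIV. sc (A $ (s x, s y) $ p * B $ (s z, s w) $ q)
        (\<psi> (s(z := fst q, w := snd q, x := fst p, y := snd p))))"
    using ne by (simp add: site2_eq_sum_pairs scale_sum_right upd)
  also have "\<dots> = (\<Sum>q\<in>UNIV. \<Sum>p\<in>UNIV. sc (A $ (s x, s y) $ p * B $ (s z, s w) $ q)
        (\<psi> (s(z := fst q, w := snd q, x := fst p, y := snd p))))"
    by (rule sum.swap)
  also have "\<dots> = (site2 sc z w B \<circ> site2 sc x y A) \<psi> s"
    using ne by (simp add: site2_eq_sum_pairs scale_sum_right mult.commute)
  finally show "(site2 sc x y A \<circ> site2 sc z w B) \<psi> s = (site2 sc z w B \<circ> site2 sc x y A) \<psi> s" .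
qed

text \<open>
  Linearity of the entries of \<open>K\<close> enters here: an entry acts on the quantum space and has to be
  moved past a linear combination of vectors.
\<close>

lemma siteq_site2_commute:
  fixes z :: "'l::finite" and B :: "'d::finite mat2"
  assumes lin: "\<And>a b. Vector_Spaces.linear sc sc (K $ a $ b)" and "z \<notin> {x, y}"
  shows "siteq z K \<circ> site2 sc x y B = site2 sc x y B \<circ> siteq z K"
proof (intro ext)
  fix \<psi> and s :: "'l \<Rightarrow> 'd"
  have ne: "z \<noteq> x" "x \<noteq> z" "z \<noteq> y" "y \<noteq> z"
    using assms(2) by auto
  have upd: "s(z := c, x := a, y := b) = s(x := a, y := b, z := c)" for a b c
    using ne by (auto simp: fun_eq_iff)
  have "(siteq z K \<circ> site2 sc x y B) \<psi> s =
      (\<Sum>c\<in>UNIV. \<Sum>p\<in>UNIV.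
        sc (B $ (s x, s y) $ p) ((K $ s z $ c) (\<psi> (s(x := fst p, y := snd p, z := c)))))"
    using ne by (simp add: siteq_def site2_eq_sum_pairs upd linear_map_sum[OF lin] linear_map_scale[OF lin])
  also have "\<dots> = (\<Sum>p\<in>UNIV. \<Sum>c\<in>UNIV.
        sc (B $ (s x, s y) $ p) ((K $ s z $ c) (\<psi> (s(x := fst p, y := snd p, z := c)))))"
    by (rule sum.swap)
  also have "\<dots> = (site2 sc x y B \<circ> siteq z K) \<psi> s"
    using ne by (simp add: siteq_def site2_eq_sum_pairs scale_sum_right)
  finally show "(siteq z K \<circ> site2 sc x y B) \<psi> s = (site2 sc x y B \<circ> siteq z K) \<psi> s" .
qed

lemma site2_mult:
  fixes x :: "'l::finite" and A :: "'d::finite mat2"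
  assumes "x \<noteq> y"
  shows "site2 sc x y A \<circ> site2 sc x y B = site2 sc x y (A ** B)"
proof (intro ext)
  fix \<psi> and s :: "'l \<Rightarrow> 'd"
  have "(site2 sc x y A \<circ> site2 sc x y B) \<psi> s =
      (\<Sum>p\<in>UNIV. \<Sum>q\<in>UNIV. sc (A $ (s x, s y) $ p * B $ p $ q) (\<psi> (s(x := fst q, y := snd q))))"
    using assms by (simp add: site2_eq_sum_pairs scale_sum_right fun_upd_twist)
  also have "\<dots> = (\<Sum>q\<in>UNIV. \<Sum>p\<in>UNIV. sc (A $ (s x, s y) $ p * B $ p $ q) (\<psi> (s(x := fst q, y := snd q))))"
    by (rule sum.swap)
  also have "\<dots> = site2 sc x y (A ** B) \<psi> s"
    by (simp add: site2_eq_sum_pairs matrix_matrix_mult_def scale_sum_left)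
  finally show "(site2 sc x y A \<circ> site2 sc x y B) \<psi> s = site2 sc x y (A ** B) \<psi> s" .
qed

lemma site1_mult:
  fixes x :: "'l::finite" and A :: "'d::finite mat1"
  shows "site1 sc x A \<circ> site1 sc x B = site1 sc x (A ** B)"
proof (intro ext)
  fix \<psi> and s :: "'l \<Rightarrow> 'd"
  have "(site1 sc x A \<circ> site1 sc x B) \<psi> s =
      (\<Sum>a\<in>UNIV. \<Sum>b\<in>UNIV. sc (A $ s x $ a * B $ a $ b) (\<psi> (s(x := b))))"
    by (simp add: site1_def scale_sum_right)
  also have "\<dots> = (\<Sum>b\<in>UNIV. \<Sum>a\<in>UNIV. sc (A $ s x $ a * B $ a $ b) (\<psi> (s(x := b))))"
    by (rule sum.swap)
  also have "\<dots> = site1 sc x (A ** B) \<psi> s"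
    by (simp add: site1_def matrix_matrix_mult_def scale_sum_left)
  finally show "(site1 sc x A \<circ> site1 sc x B) \<psi> s = site1 sc x (A ** B) \<psi> s" .
qed

lemma site1_one: "site1 sc x (mat 1) = id"
  by (auto simp: site1_def mat_def fun_eq_iff if_distrib[of "\<lambda>c. sc c _"] cong: if_cong)

lemma site1_inverse: "A ** B = mat 1 \<Longrightarrow> site1 sc x A \<circ> site1 sc x B = id"
  by (simp add: site1_mult site1_one)

text \<open>
  One-site matrices are viewed as two-site matrices, so that conjugating an operator by them becomes a
  product of matrices.
\<close>

lemma site1_eq_site2_left:
  "x \<noteq> y \<Longrightarrow> site1 sc x A = site2 sc x y (tensor A (mat 1))"
  by (auto simp: site1_def site2_def tensor_def mat_def fun_eq_iff if_distrib[of "\<lambda>c. _ * c"]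
      if_distrib[of "\<lambda>c. sc c _"] fun_upd_idem fun_upd_twist cong: if_cong)

lemma site1_eq_site2_right:
  fixes x y :: "'l::finite" and A :: "'d::finite mat1"
  assumes "x \<noteq> y"
  shows "site1 sc y A = site2 sc x y (tensor (mat 1) A)"
proof (intro ext)
  fix \<psi> and s :: "'l \<Rightarrow> 'd"
  have "site2 sc x y (tensor (mat 1) A) \<psi> s =
      (\<Sum>b\<in>UNIV. \<Sum>a\<in>UNIV. sc (tensor (mat 1) A $ (s x, s y) $ (a, b)) (\<psi> (s(x := a, y := b))))"
    unfolding site2_def by (rule sum.swap)
  also have "\<dots> = site1 sc y A \<psi> s"
    by (simp add: site1_def tensor_def mat_def if_distrib[of "\<lambda>c. c * _"]
        if_distrib[of "\<lambda>c. sc c _"] cong: if_cong)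
  finally show "site1 sc y A \<psi> s = site2 sc x y (tensor (mat 1) A) \<psi> s" by simp
qed

end

lemma tensor_mult:
  fixes A B C D :: "'d::finite mat1"
  shows "tensor A B ** tensor C D = tensor (A ** C) (B ** D)"
  by (simp add: tensor_def matrix_matrix_mult_def vec_eq_iff sum_product sum.cartesian_product split_def mult_ac)

text \<open>
  Conjugation by \<open>M \<otimes> M\<close> fixes \<open>B\<close>; splitting it between the factors, conjugation by \<open>M\<close> in the first factor is
  conjugation by the inverse of \<open>M\<close> in the second one.
\<close>

lemma tensor_conj_swap:
  fixes B :: "'d::finite mat2"
  assumes comm: "B ** tensor M M = tensor M M ** B" and inv: "M ** M' = mat 1" "M' ** M = mat 1"
  shows "tensor M (mat 1) ** B ** tensor M' (mat 1) = tensor (mat 1) M' ** B ** tensor (mat 1) M"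
proof -
  have "tensor M (mat 1) ** B ** tensor M' (mat 1) = tensor (mat 1) M' ** (tensor M M ** B) ** tensor M' (mat 1)"
    by (simp add: matrix_mul_assoc tensor_mult inv)
  also have "\<dots> = tensor (mat 1) M' ** B ** (tensor M M ** tensor M' (mat 1))"
    by (simp add: comm[symmetric] matrix_mul_assoc)
  also have "\<dots> = tensor (mat 1) M' ** B ** tensor (mat 1) M"
    by (simp add: tensor_mult inv)
  finally show ?thesis .
qed

section \<open>Ordered products over two lists of labels\<close>

text \<open>
  In contrast to \<^const>\<open>fusedR\<close>, the matrix attached to a pair of labels is arbitrary. The conjugates
  of \<open>R\<close> by \<open>M\<close>, which depend on the two spectral parameters separately, are thus included.
\<close>

definition fused ::
  "(complex \<Rightarrow> 'h \<Rightarrow> 'h::ab_group_add) \<Rightarrow> ('l::finite \<Rightarrow> 'l \<Rightarrow> 'd::finite mat2) \<Rightarrow>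
     'l list \<Rightarrow> 'l list \<Rightarrow> ('l, 'd, 'h) op" where
  "fused sc F X Y = oprod [site2 sc x y (F x y). y \<leftarrow> Y, x \<leftarrow> X]"

text \<open>
  This is \<^const>\<open>K0\<close> with the conjugations by \<open>M\<close> absorbed into the matrices \<open>A x z\<close>. For a
  list of length one the product over \<open>ys\<close> is the identity, as in \<^const>\<open>K0\<close>.
\<close>

fun dressed ::
  "(complex \<Rightarrow> 'h \<Rightarrow> 'h::ab_group_add) \<Rightarrow> ('l::finite \<Rightarrow> 'l \<Rightarrow> 'd::finite mat2) \<Rightarrow>
     ('l \<Rightarrow> ('h \<Rightarrow> 'h) ^ 'd ^ 'd) \<Rightarrow> 'l list \<Rightarrow> ('l, 'd, 'h) op" where
  "dressed sc A k [] = id"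
| "dressed sc A k (x # ys) = dressed sc A k ys \<circ> fused sc A [x] (rev ys) \<circ> siteq x (k x)"

lemma oprod_simps [simp]:
  "oprod [] = id" "oprod (f # fs) = f \<circ> oprod fs" "oprod (fs @ gs) = oprod fs \<circ> oprod gs"
proof -
  show "oprod (fs @ gs) = oprod fs \<circ> oprod gs"
    by (induction fs) (simp_all add: oprod_def o_assoc)
qed (simp_all add: oprod_def)

lemma oprod_commute:
  "(\<And>f. f \<in> set fs \<Longrightarrow> g \<circ> f = f \<circ> g) \<Longrightarrow> g \<circ> oprod fs = oprod fs \<circ> g"
proof (induction fs)
  case (Cons f fs)
  have "g \<circ> oprod (f # fs) = (g \<circ> f) \<circ> oprod fs" by (simp add: o_assoc)
  also have "g \<circ> f = f \<circ> g" by (rule Cons.prems) simp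
  also have "f \<circ> g \<circ> oprod fs = f \<circ> (g \<circ> oprod fs)" by (simp add: o_assoc)
  also have "g \<circ> oprod fs = oprod fs \<circ> g" by (intro Cons.IH Cons.prems) simp
  finally show ?case by (simp add: o_assoc)
qed simp

lemma fused_simps [simp]:
  "fused sc F [] Y = id" "fused sc F X [] = id"
  "fused sc F X (Y @ Y') = fused sc F X Y \<circ> fused sc F X Y'"
  "fused sc F [x] [y] = site2 sc x y (F x y)"
proof -
  show "fused sc F [] Y = id" by (induction Y) (simp_all add: fused_def)
qed (simp_all add: fused_def)

lemma fused_Cons_right: "fused sc F X (y # Y) = fused sc F X [y] \<circ> fused sc F X Y"
  using fused_simps(3)[of sc F X "[y]" Y] by simp

context complex_space
begin

lemma site2_fused_commute:
  assumes "{x, y} \<inter> (set X \<union> set Y) = {}"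
  shows "site2 sc x y B \<circ> fused sc F X Y = fused sc F X Y \<circ> site2 sc x y B"
  unfolding fused_def using assms
  by (intro oprod_commute) (auto intro: site2_site2_commute)

lemma fused_fused_commute:
  assumes "(set X \<union> set Y) \<inter> (set Z \<union> set W) = {}"
  shows "fused sc F X Y \<circ> fused sc G Z W = fused sc G Z W \<circ> fused sc F X Y"
proof -
  have "fused sc G Z W \<circ> fused sc F X Y = fused sc F X Y \<circ> fused sc G Z W"
    unfolding fused_def[of sc F] using assms
    by (intro oprod_commute) (auto intro!: site2_fused_commute[symmetric])
  then show ?thesis by simp
qed

lemma siteq_fused_commute:
  assumes "\<And>a b. Vector_Spaces.linear sc sc (K $ a $ b)" "z \<notin> set X \<union> set Y"
  shows "siteq z K \<circ> fused sc F X Y = fused sc F X Y \<circ> siteq z K"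
  unfolding fused_def using assms
  by (intro oprod_commute) (auto intro: siteq_site2_commute)

text \<open>
  The product runs through the second list in its outer loop, so splitting the second list is a
  matter of associativity; splitting the first one requires commuting factors with four
  different labels.
\<close>

lemma fused_append_left:
  assumes "distinct (X @ X')" "set (X @ X') \<inter> set Y = {}" "distinct Y"
  shows "fused sc F (X @ X') Y = fused sc F X Y \<circ> fused sc F X' Y"
  using assms(2,3)
proof (induction Y)
  case (Cons y Y)
  have "fused sc F (X @ X') (y # Y) = fused sc F X [y] \<circ> fused sc F X' [y] \<circ> fused sc F (X @ X') Y"
    by (simp add: fused_def o_assoc)
  also have "fused sc F (X @ X') Y = fused sc F X Y \<circ> fused sc F X' Y"
    using Cons by auto
  also have "fused sc F X [y] \<circ> fused sc F X' [y] \<circ> (fused sc F X Y \<circ> fused sc F X' Y) =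
      fused sc F X [y] \<circ> (fused sc F X' [y] \<circ> fused sc F X Y) \<circ> fused sc F X' Y"
    by (simp add: o_assoc)
  also have "fused sc F X' [y] \<circ> fused sc F X Y = fused sc F X Y \<circ> fused sc F X' [y]"
    using Cons.prems assms(1) by (intro fused_fused_commute) auto
  finally show ?case
    by (simp add: o_assoc fused_Cons_right[of _ _ _ y Y])
qed simp

end

section \<open>The fusion argument\<close>

text \<open>
  All that the fusion argument knows about the operators. The names of the assumptions spell
  the order of the factors on the left-hand sides.
\<close>

locale exchange_relations = complex_space sc
  for sc :: "complex \<Rightarrow> 'h \<Rightarrow> 'h::ab_group_add" +
  fixes A D E :: "'l::finite \<Rightarrow> 'l \<Rightarrow> 'd::finite mat2"
    and k :: "'l \<Rightarrow> ('h \<Rightarrow> 'h) ^ 'd ^ 'd"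
  assumes linear_k: "\<And>x a b. Vector_Spaces.linear sc sc (k x $ a $ b)"
    and DAA: "\<And>x y z. distinct [x, y, z] \<Longrightarrow>
      site2 sc x y (D x y) \<circ> site2 sc x z (A x z) \<circ> site2 sc y z (A y z) =
      site2 sc y z (A y z) \<circ> site2 sc x z (A x z) \<circ> site2 sc x y (D x y)"
    and AAE: "\<And>x y z. distinct [x, y, z] \<Longrightarrow>
      site2 sc x y (A x y) \<circ> site2 sc x z (A x z) \<circ> site2 sc y z (E y z) =
      site2 sc y z (E y z) \<circ> site2 sc x z (A x z) \<circ> site2 sc x y (A x y)"
    and DkAk: "\<And>x y. x \<noteq> y \<Longrightarrow>
      site2 sc x y (D x y) \<circ> siteq x (k x) \<circ> site2 sc y x (A y x) \<circ> siteq y (k y) =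
      siteq y (k y) \<circ> site2 sc x y (A x y) \<circ> siteq x (k x) \<circ> site2 sc y x (E y x)"
begin

abbreviation fused_A ("\<A>") where "\<A> \<equiv> fused sc A"
abbreviation fused_D ("\<D>") where "\<D> \<equiv> fused sc D"
abbreviation fused_E ("\<E>") where "\<E> \<equiv> fused sc E"
abbreviation dressed_k ("\<K>") where "\<K> \<equiv> dressed sc A k"
abbreviation site_k ("\<kappa>") where "\<kappa> x \<equiv> siteq x (k x)"

text \<open>
  From here on, identities between operators are applied to a vector. Associativity of composition
  then holds by syntax, and any consecutive factors can be rewritten in place.
\<close>

lemma fused_swap:
  assumes "(set X \<union> set Y) \<inter> (set Z \<union> set W) = {}"
  shows "fused sc F X Y (fused sc G Z W \<psi>) = fused sc G Z W (fused sc F X Y \<psi>)"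
  using fun_cong[OF fused_fused_commute[OF assms]] by simp

lemma k_fused_swap:
  assumes "z \<notin> set X \<union> set Y"
  shows "\<kappa> z (fused sc F X Y \<psi>) = fused sc F X Y (\<kappa> z \<psi>)"
  using fun_cong[OF siteq_fused_commute[OF linear_k assms]] by simp

lemma dressed_fused_swap:
  assumes "set N \<inter> (set X \<union> set Y) = {}"
  shows "\<K> N (fused sc F X Y \<psi>) = fused sc F X Y (\<K> N \<psi>)"
  using assms
proof (induction N arbitrary: \<psi>)
  case (Cons x N)
  have s: "\<kappa> x (fused sc F X Y \<psi>) = fused sc F X Y (\<kappa> x \<psi>)" for \<psi>
    using Cons.prems by (intro k_fused_swap) auto
  have f: "\<A> [x] (rev N) (fused sc F X Y \<psi>) = fused sc F X Y (\<A> [x] (rev N) \<psi>)" for \<psi>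
    using Cons.prems by (intro fused_swap) auto
  show ?case using Cons by (simp add: s f)
qed simp

lemma fused_Cons_left:
  assumes "distinct (x # X @ Y)"
  shows "fused sc F (x # X) Y \<psi> = fused sc F [x] Y (fused sc F X Y \<psi>)"
  using fused_append_left[of "[x]" X Y F] assms by auto

lemma fused_snoc_left:
  assumes "distinct (x # X @ Y)"
  shows "fused sc F (X @ [x]) Y \<psi> = fused sc F X Y (fused sc F [x] Y \<psi>)"
  using fused_append_left[of X "[x]" Y F] assms by auto

lemma fused_Cons_right_apply: "fused sc F X (y # Y) \<psi> = fused sc F X [y] (fused sc F X Y \<psi>)"
  by (simp add: fused_Cons_right[of _ _ _ y Y])

lemma AAE_apply: "distinct [x, y, z] \<Longrightarrow> \<A> [x] [y] (\<A> [x] [z] (\<E> [y] [z] \<psi>)) = \<E> [y] [z] (\<A> [x] [z] (\<A> [x] [y] \<psi>))"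
  using AAE[of x y z] by (simp add: fun_eq_iff)

lemma DAA_apply: "distinct [x, y, z] \<Longrightarrow> \<A> [y] [z] (\<A> [x] [z] (\<D> [x] [y] \<psi>)) = \<D> [x] [y] (\<A> [x] [z] (\<A> [y] [z] \<psi>))"
  using DAA[of x y z] by (simp add: fun_eq_iff)

text \<open>
  The factors with \<open>q\<close> can be brought together, since \<open>\<A> [a] Q\<close> and \<open>\<E> [x] [q]\<close> have no label in
  common; then \<open>\<A> [a] [x]\<close> is passed through one triple after the other.
\<close>

lemma AAE_row:
  assumes "distinct (a # x # Q)"
  shows "\<A> [a] [x] (\<A> [a] Q (\<E> [x] Q \<psi>)) = \<E> [x] Q (\<A> [a] Q (\<A> [a] [x] \<psi>))"
  using assms
proof (induction Q arbitrary: \<psi>)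
  case (Cons q Q)
  have "\<A> [a] [x] (\<A> [a] (q # Q) (\<E> [x] (q # Q) \<psi>)) =
      \<A> [a] [x] (\<A> [a] [q] (\<A> [a] Q (\<E> [x] [q] (\<E> [x] Q \<psi>))))"
    by (simp only: fused_Cons_right_apply[of _ _ q Q])
  also have "\<A> [a] Q (\<E> [x] [q] (\<E> [x] Q \<psi>)) = \<E> [x] [q] (\<A> [a] Q (\<E> [x] Q \<psi>))"
    using Cons.prems by (intro fused_swap) auto
  also have "\<A> [a] [x] (\<A> [a] [q] (\<E> [x] [q] (\<A> [a] Q (\<E> [x] Q \<psi>)))) =
      \<E> [x] [q] (\<A> [a] [q] (\<A> [a] [x] (\<A> [a] Q (\<E> [x] Q \<psi>))))"
    using Cons.prems by (intro AAE_apply) auto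
  also have "\<A> [a] [x] (\<A> [a] Q (\<E> [x] Q \<psi>)) = \<E> [x] Q (\<A> [a] Q (\<A> [a] [x] \<psi>))"
    using Cons.prems by (intro Cons.IH) auto
  also have "\<A> [a] [q] (\<E> [x] Q (\<A> [a] Q (\<A> [a] [x] \<psi>))) =
      \<E> [x] Q (\<A> [a] [q] (\<A> [a] Q (\<A> [a] [x] \<psi>)))"
    using Cons.prems by (intro fused_swap) auto
  finally show ?case
    by (simp only: fused_Cons_right_apply[of _ _ q Q])
qed simp

text \<open>
  The rows \<open>\<E> [x] Q\<close> are moved one at a time. As the first label of \<open>N\<close> stands last in \<open>rev N\<close>, the
  factor \<open>\<A> [a] [x]\<close> needed for the first row is already at the right place.
\<close>

lemma AAE_fused:
  assumes "distinct (a # N @ Q)"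
  shows "\<A> [a] (rev N) (\<A> [a] Q (\<E> N Q \<psi>)) = \<E> N Q (\<A> [a] Q (\<A> [a] (rev N) \<psi>))"
  using assms
proof (induction N arbitrary: \<psi>)
  case (Cons x N)
  have cons: "\<E> (x # N) Q \<psi> = \<E> [x] Q (\<E> N Q \<psi>)" for \<psi>
    using fused_Cons_left[of x N Q E] Cons.prems by auto
  have snoc: "\<A> [a] (rev (x # N)) \<psi> = \<A> [a] (rev N) (\<A> [a] [x] \<psi>)" for \<psi>
    by (simp del: fused_simps(4))
  have "\<A> [a] (rev (x # N)) (\<A> [a] Q (\<E> (x # N) Q \<psi>)) =
      \<A> [a] (rev N) (\<A> [a] [x] (\<A> [a] Q (\<E> [x] Q (\<E> N Q \<psi>))))"
    by (simp only: cons snoc)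
  also have "\<A> [a] [x] (\<A> [a] Q (\<E> [x] Q (\<E> N Q \<psi>))) = \<E> [x] Q (\<A> [a] Q (\<A> [a] [x] (\<E> N Q \<psi>)))"
    using Cons.prems by (intro AAE_row) auto
  also have "\<A> [a] [x] (\<E> N Q \<psi>) = \<E> N Q (\<A> [a] [x] \<psi>)"
    using Cons.prems by (intro fused_swap) auto
  also have "\<A> [a] (rev N) (\<E> [x] Q (\<A> [a] Q (\<E> N Q (\<A> [a] [x] \<psi>)))) =
      \<E> [x] Q (\<A> [a] (rev N) (\<A> [a] Q (\<E> N Q (\<A> [a] [x] \<psi>))))"
    using Cons.prems by (intro fused_swap) auto
  also have "\<A> [a] (rev N) (\<A> [a] Q (\<E> N Q (\<A> [a] [x] \<psi>))) =
      \<E> N Q (\<A> [a] Q (\<A> [a] (rev N) (\<A> [a] [x] \<psi>)))"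
    using Cons.prems by (intro Cons.IH) auto
  finally show ?case
    by (simp only: cons snoc)
qed simp

lemma DAA_row:
  assumes "distinct (a # x # Q)"
  shows "\<A> [x] Q (\<A> [a] Q (\<D> [a] [x] \<psi>)) = \<D> [a] [x] (\<A> [a] Q (\<A> [x] Q \<psi>))"
  using assms
proof (induction Q arbitrary: \<psi>)
  case (Cons q Q)
  have "\<A> [x] (q # Q) (\<A> [a] (q # Q) (\<D> [a] [x] \<psi>)) =
      \<A> [x] [q] (\<A> [x] Q (\<A> [a] [q] (\<A> [a] Q (\<D> [a] [x] \<psi>))))"
    by (simp only: fused_Cons_right_apply[of _ _ q Q])
  also have "\<A> [x] Q (\<A> [a] [q] (\<A> [a] Q (\<D> [a] [x] \<psi>))) = \<A> [a] [q] (\<A> [x] Q (\<A> [a] Q (\<D> [a] [x] \<psi>)))"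
    using Cons.prems by (intro fused_swap) auto
  also have "\<A> [x] Q (\<A> [a] Q (\<D> [a] [x] \<psi>)) = \<D> [a] [x] (\<A> [a] Q (\<A> [x] Q \<psi>))"
    using Cons.prems by (intro Cons.IH) auto
  also have "\<A> [x] [q] (\<A> [a] [q] (\<D> [a] [x] (\<A> [a] Q (\<A> [x] Q \<psi>)))) =
      \<D> [a] [x] (\<A> [a] [q] (\<A> [x] [q] (\<A> [a] Q (\<A> [x] Q \<psi>))))"
    using Cons.prems by (intro DAA_apply) auto
  also have "\<A> [x] [q] (\<A> [a] Q (\<A> [x] Q \<psi>)) = \<A> [a] Q (\<A> [x] [q] (\<A> [x] Q \<psi>))"
    using Cons.prems by (intro fused_swap) auto
  finally show ?case
    by (simp only: fused_Cons_right_apply[of _ _ q Q])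
qed simp

lemma DAA_fused:
  assumes "distinct (a # N @ Q)"
  shows "\<A> (rev N) Q (\<A> [a] Q (\<D> [a] N \<psi>)) = \<D> [a] N (\<A> [a] Q (\<A> (rev N) Q \<psi>))"
  using assms
proof (induction N arbitrary: \<psi>)
  case (Cons x N)
  have snoc: "\<A> (rev (x # N)) Q \<psi> = \<A> (rev N) Q (\<A> [x] Q \<psi>)" for \<psi>
    using Cons.prems by (simp add: fused_snoc_left)
  have "\<A> (rev (x # N)) Q (\<A> [a] Q (\<D> [a] (x # N) \<psi>)) =
      \<A> (rev N) Q (\<A> [x] Q (\<A> [a] Q (\<D> [a] [x] (\<D> [a] N \<psi>))))"
    by (simp only: snoc fused_Cons_right_apply[of _ _ x N])
  also have "\<A> [x] Q (\<A> [a] Q (\<D> [a] [x] (\<D> [a] N \<psi>))) = \<D> [a] [x] (\<A> [a] Q (\<A> [x] Q (\<D> [a] N \<psi>)))"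
    using Cons.prems by (intro DAA_row) auto
  also have "\<A> [x] Q (\<D> [a] N \<psi>) = \<D> [a] N (\<A> [x] Q \<psi>)"
    using Cons.prems by (intro fused_swap) auto
  also have "\<A> (rev N) Q (\<D> [a] [x] (\<A> [a] Q (\<D> [a] N (\<A> [x] Q \<psi>)))) =
      \<D> [a] [x] (\<A> (rev N) Q (\<A> [a] Q (\<D> [a] N (\<A> [x] Q \<psi>))))"
    using Cons.prems by (intro fused_swap) auto
  also have "\<A> (rev N) Q (\<A> [a] Q (\<D> [a] N (\<A> [x] Q \<psi>))) =
      \<D> [a] N (\<A> [a] Q (\<A> (rev N) Q (\<A> [x] Q \<psi>)))"
    using Cons.prems by (intro Cons.IH) auto
  finally show ?case
    by (simp only: snoc fused_Cons_right_apply[of _ _ x N])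
qed simp

text \<open>
  Each step applies the reflection relation to the first label \<open>x\<close> of \<open>N\<close>. The factors \<open>\<A> [x] (rev N)\<close>
  by which \<open>\<K> (x # N)\<close> exceeds \<open>\<K> N\<close> are in the way of the resulting \<open>\<D> [a] [x]\<close> on their right and of
  the remaining \<open>\<E> N [a]\<close>; the two Yang--Baxter relations move both through.
\<close>

lemma reflection_single:
  assumes "distinct (a # N)"
  shows "\<K> N (\<A> [a] (rev N) (\<kappa> a (\<E> N [a] \<psi>))) = \<D> [a] N (\<kappa> a (\<A> (rev N) [a] (\<K> N \<psi>)))"
  using assms
proof (induction N arbitrary: \<psi>)
  case (Cons x N)
  have snoc: "\<A> (rev (x # N)) [a] \<psi> = \<A> (rev N) [a] (\<A> [x] [a] \<psi>)" for \<psi>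
    using fused_snoc_left[of x "rev N" "[a]"] Cons.prems by (auto simp del: fused_simps)
  have cons: "\<E> (x # N) [a] \<psi> = \<E> [x] [a] (\<E> N [a] \<psi>)" for \<psi>
    using fused_Cons_left[of x N "[a]"] Cons.prems by (auto simp del: fused_simps)
  have rsnoc: "\<A> [a] (rev (x # N)) \<psi> = \<A> [a] (rev N) (\<A> [a] [x] \<psi>)" for \<psi>
    by (simp del: fused_simps(4))
  have Kx: "\<K> (x # N) \<psi> = \<K> N (\<A> [x] (rev N) (\<kappa> x \<psi>))" for \<psi>
    by simp
  have "\<K> (x # N) (\<A> [a] (rev (x # N)) (\<kappa> a (\<E> (x # N) [a] \<psi>))) =
      \<K> N (\<A> [x] (rev N) (\<kappa> x (\<A> [a] (rev N) (\<A> [a] [x] (\<kappa> a (\<E> [x] [a] (\<E> N [a] \<psi>)))))))"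
    by (simp only: cons rsnoc Kx)
  also have "\<kappa> x (\<A> [a] (rev N) (\<A> [a] [x] (\<kappa> a (\<E> [x] [a] (\<E> N [a] \<psi>))))) =
      \<A> [a] (rev N) (\<kappa> x (\<A> [a] [x] (\<kappa> a (\<E> [x] [a] (\<E> N [a] \<psi>)))))"
    using Cons.prems by (intro k_fused_swap) auto
  \<comment> \<open>The reflection relation itself, for the pair of labels \<open>a\<close>, \<open>x\<close>.\<close>
  also have "\<kappa> x (\<A> [a] [x] (\<kappa> a (\<E> [x] [a] (\<E> N [a] \<psi>)))) =
      \<D> [a] [x] (\<kappa> a (\<A> [x] [a] (\<kappa> x (\<E> N [a] \<psi>))))"
    using DkAk[of a x] Cons.prems by (simp add: fun_eq_iff)
  also have "\<kappa> x (\<E> N [a] \<psi>) = \<E> N [a] (\<kappa> x \<psi>)"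
    using Cons.prems by (intro k_fused_swap) auto
  also have "\<A> [x] (rev N) (\<A> [a] (rev N) (\<D> [a] [x] (\<kappa> a (\<A> [x] [a] (\<E> N [a] (\<kappa> x \<psi>)))))) =
      \<D> [a] [x] (\<A> [a] (rev N) (\<A> [x] (rev N) (\<kappa> a (\<A> [x] [a] (\<E> N [a] (\<kappa> x \<psi>))))))"
    using Cons.prems by (intro DAA_row) auto
  also have "\<A> [x] (rev N) (\<kappa> a (\<A> [x] [a] (\<E> N [a] (\<kappa> x \<psi>)))) =
      \<kappa> a (\<A> [x] (rev N) (\<A> [x] [a] (\<E> N [a] (\<kappa> x \<psi>))))"
    using Cons.prems by (intro k_fused_swap[symmetric]) auto
  also have "\<A> [x] (rev N) (\<A> [x] [a] (\<E> N [a] (\<kappa> x \<psi>))) =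
      \<E> N [a] (\<A> [x] [a] (\<A> [x] (rev N) (\<kappa> x \<psi>)))"
    using Cons.prems by (intro AAE_fused) auto
  also have "\<K> N (\<D> [a] [x] (\<A> [a] (rev N) (\<kappa> a (\<E> N [a] (\<A> [x] [a] (\<A> [x] (rev N) (\<kappa> x \<psi>))))))) =
      \<D> [a] [x] (\<K> N (\<A> [a] (rev N) (\<kappa> a (\<E> N [a] (\<A> [x] [a] (\<A> [x] (rev N) (\<kappa> x \<psi>)))))))"
    using Cons.prems by (intro dressed_fused_swap) auto
  also have "\<K> N (\<A> [a] (rev N) (\<kappa> a (\<E> N [a] (\<A> [x] [a] (\<A> [x] (rev N) (\<kappa> x \<psi>)))))) =
      \<D> [a] N (\<kappa> a (\<A> (rev N) [a] (\<K> N (\<A> [x] [a] (\<A> [x] (rev N) (\<kappa> x \<psi>))))))"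
    using Cons.prems by (intro Cons.IH) auto
  also have "\<K> N (\<A> [x] [a] (\<A> [x] (rev N) (\<kappa> x \<psi>))) = \<A> [x] [a] (\<K> N (\<A> [x] (rev N) (\<kappa> x \<psi>)))"
    using Cons.prems by (intro dressed_fused_swap) auto
  finally show ?case
    by (simp only: snoc fused_Cons_right_apply[of _ _ x N] Kx)
qed simp

text \<open>
  For a new first label \<open>a\<close>, the part that involves \<open>a\<close> is moved to the right of everything else, so
  that the induction hypothesis applies to \<open>N\<close> and \<open>P\<close>. The case of the single label \<open>a\<close> then applies to what
  is left, and the factors \<open>\<D> [a] N\<close> it produces are moved back to the left.
\<close>

theorem generalized_reflection:
  assumes "distinct (N @ P)"
  shows "\<K> N (\<A> (rev P) (rev N) (\<K> P (\<E> N (rev P) \<psi>))) = \<D> (rev P) N (\<K> P (\<A> (rev N) (rev P) (\<K> N \<psi>)))"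
  using assms
proof (induction P arbitrary: \<psi>)
  case (Cons a P)
  have snoc: "fused sc F (rev (a # P)) X \<psi> = fused sc F (rev P) X (fused sc F [a] X \<psi>)"
    if "distinct X" "set X = set N" for F X \<psi>
    using fused_snoc_left[of a "rev P" X] Cons.prems that by (auto simp del: fused_simps)
  have rsnoc: "fused sc F X (rev (a # P)) \<psi> = fused sc F X (rev P) (fused sc F X [a] \<psi>)" for F X \<psi>
    by (simp del: fused_simps(4))
  have Ka: "\<K> (a # P) \<psi> = \<K> P (\<A> [a] (rev P) (\<kappa> a \<psi>))" for \<psi>
    by simp
  have dN: "distinct N" "distinct (rev N)" "set (rev N) = set N" using Cons.prems by auto
  have "\<K> N (\<A> (rev (a # P)) (rev N) (\<K> (a # P) (\<E> N (rev (a # P)) \<psi>))) =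
     \<K> N (\<A> (rev P) (rev N) (\<A> [a] (rev N) (\<K> P (\<A> [a] (rev P) (\<kappa> a (\<E> N (rev P) (\<E> N [a] \<psi>)))))))"
    by (simp only: snoc[OF dN(2,3)] rsnoc Ka)
  also have "\<kappa> a (\<E> N (rev P) (\<E> N [a] \<psi>)) = \<E> N (rev P) (\<kappa> a (\<E> N [a] \<psi>))"
    using Cons.prems by (intro k_fused_swap) auto
  also have "\<A> [a] (rev N) (\<K> P (\<A> [a] (rev P) (\<E> N (rev P) (\<kappa> a (\<E> N [a] \<psi>))))) =
     \<K> P (\<A> [a] (rev N) (\<A> [a] (rev P) (\<E> N (rev P) (\<kappa> a (\<E> N [a] \<psi>)))))"
    using Cons.prems by (intro dressed_fused_swap[symmetric]) auto
  also have "\<A> [a] (rev N) (\<A> [a] (rev P) (\<E> N (rev P) (\<kappa> a (\<E> N [a] \<psi>)))) =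
     \<E> N (rev P) (\<A> [a] (rev P) (\<A> [a] (rev N) (\<kappa> a (\<E> N [a] \<psi>))))"
    using Cons.prems by (intro AAE_fused) auto
  \<comment> \<open>Induction hypothesis for the vector to which the first four operators are applied.\<close>
  also have "\<K> N (\<A> (rev P) (rev N) (\<K> P (\<E> N (rev P) (\<A> [a] (rev P) (\<A> [a] (rev N) (\<kappa> a (\<E> N [a] \<psi>))))))) =
     \<D> (rev P) N (\<K> P (\<A> (rev N) (rev P) (\<K> N (\<A> [a] (rev P) (\<A> [a] (rev N) (\<kappa> a (\<E> N [a] \<psi>)))))))"
    using Cons.prems by (intro Cons.IH) auto
  also have "\<K> N (\<A> [a] (rev P) (\<A> [a] (rev N) (\<kappa> a (\<E> N [a] \<psi>)))) =
     \<A> [a] (rev P) (\<K> N (\<A> [a] (rev N) (\<kappa> a (\<E> N [a] \<psi>))))"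
    using Cons.prems by (intro dressed_fused_swap) auto
  also have "\<K> N (\<A> [a] (rev N) (\<kappa> a (\<E> N [a] \<psi>))) = \<D> [a] N (\<kappa> a (\<A> (rev N) [a] (\<K> N \<psi>)))"
    using Cons.prems by (intro reflection_single) auto
  also have "\<A> (rev N) (rev P) (\<A> [a] (rev P) (\<D> [a] N (\<kappa> a (\<A> (rev N) [a] (\<K> N \<psi>))))) =
     \<D> [a] N (\<A> [a] (rev P) (\<A> (rev N) (rev P) (\<kappa> a (\<A> (rev N) [a] (\<K> N \<psi>)))))"
    using Cons.prems by (intro DAA_fused) auto
  also have "\<A> (rev N) (rev P) (\<kappa> a (\<A> (rev N) [a] (\<K> N \<psi>))) = \<kappa> a (\<A> (rev N) (rev P) (\<A> (rev N) [a] (\<K> N \<psi>)))"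
    using Cons.prems by (intro k_fused_swap[symmetric]) auto
  also have "\<K> P (\<D> [a] N (\<A> [a] (rev P) (\<kappa> a (\<A> (rev N) (rev P) (\<A> (rev N) [a] (\<K> N \<psi>)))))) =
     \<D> [a] N (\<K> P (\<A> [a] (rev P) (\<kappa> a (\<A> (rev N) (rev P) (\<A> (rev N) [a] (\<K> N \<psi>))))))"
    using Cons.prems by (intro dressed_fused_swap) auto
  finally show ?case
    by (simp only: snoc[OF dN(1) refl] rsnoc Ka)
qed simp

end

section \<open>Transfer of few-site identities to arbitrary labels\<close>

text \<open>
  The map \<open>f\<close> places few sites among all labels. The multi-index \<open>glue f s t\<close> has the components \<open>t\<close> at
  the sites in the range of \<open>f\<close> and the frozen components \<open>s\<close> elsewhere.
\<close>

definition glue :: "('m \<Rightarrow> 'l) \<Rightarrow> ('l \<Rightarrow> 'd) \<Rightarrow> ('m \<Rightarrow> 'd) \<Rightarrow> 'l \<Rightarrow> 'd" where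
  "glue f s t = (\<lambda>x. if x \<in> range f then t (inv f x) else s x)"

lemma glue_at: "inj f \<Longrightarrow> glue f s t (f i) = t i"
  by (simp add: glue_def)

lemma glue_update: "inj f \<Longrightarrow> (glue f s t)(f i := a) = glue f s (t(i := a))"
  by (auto simp: glue_def fun_eq_iff)

lemma glue_restrict: "inj f \<Longrightarrow> glue f s (s \<circ> f) = s"
  by (auto simp: glue_def fun_eq_iff)

text \<open>
  An operator acting at labels in the range of \<open>f\<close> does not change the frozen components, so
  restricting a vector to the multi-indices \<open>glue f s t\<close> intertwines it with the operator at the
  original sites.
\<close>

lemma siteq_glue:
  "inj f \<Longrightarrow> (\<lambda>t. siteq (f i) K \<psi> (glue f s t)) = siteq i K (\<lambda>t. \<psi> (glue f s t))"
  by (simp add: siteq_def glue_at glue_update)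

lemma site1_glue:
  "inj f \<Longrightarrow> (\<lambda>t. site1 sc (f i) A \<psi> (glue f s t)) = site1 sc i A (\<lambda>t. \<psi> (glue f s t))"
  by (simp add: site1_def glue_at glue_update)

lemma site2_glue:
  "inj f \<Longrightarrow> (\<lambda>t. site2 sc (f i) (f j) A \<psi> (glue f s t)) = site2 sc i j A (\<lambda>t. \<psi> (glue f s t))"
  by (simp add: site2_def glue_at glue_update)

lemma site2_glue_functional:
  assumes "inj f" "Vector_Spaces.linear sc (*) \<phi>"
  shows "(\<lambda>t. \<phi> (site2 sc (f i) (f j) A \<psi> (glue f s t))) = site2 (*) i j A (\<lambda>t. \<phi> (\<psi> (glue f s t)))"
  by (simp add: site2_def glue_at glue_update assms(1) linear_map_sum[OF assms(2)] linear_map_scale[OF assms(2)])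

text \<open>
  The coordinates with respect to a basis already separate points.
\<close>

lemma (in vector_space) functionals_separate_points:
  assumes "\<And>\<phi>. Vector_Spaces.linear scale (*) \<phi> \<Longrightarrow> \<phi> v = \<phi> w"
  shows "v = w"
proof -
  define B where "B = extend_basis {}"
  have B: "independent B" "span B = UNIV"
    unfolding B_def by (simp_all add: independent_extend_basis independent_empty span_extend_basis)
  have "representation B v b = representation B w b" for b
    by (rule assms[OF linear_representation[OF B]])
  then have eq: "representation B v = representation B w" by (rule ext)
  have expand: "(\<Sum>b | representation B u b \<noteq> 0. scale (representation B u b) b) = u" for u
    by (rule sum_nonzero_representation_eq) (simp_all add: B)
  show ?thesis
    using expand[of v] unfolding eq expand by simp
qed

lemma glue_eqI:
  assumes "inj f" "\<And>s. (\<lambda>t. \<psi> (glue f s t)) = (\<lambda>t. \<psi>' (glue f s t))"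
  shows "\<psi> = \<psi>'"
proof
  fix s
  show "\<psi> s = \<psi>' s"
    using fun_cong[OF assms(2)[of s], of "s \<circ> f"] assms(1) by (simp add: glue_restrict)
qed

lemma inj_3: "distinct [x, y, z] \<Longrightarrow> inj (\<lambda>i::3. if i = 1 then x else if i = 2 then y else z)"
  by (auto simp: inj_def forall_3)

lemma inj_2: "x \<noteq> y \<Longrightarrow> inj (\<lambda>i::2. if i = 1 then x else y)"
  by (auto simp: inj_def forall_2)

text \<open>
  The Yang--Baxter equation is given for complex-valued vectors. A linear functional commutes with
  operators whose entries are scalars, hence both sides agree under every functional.
\<close>

lemma (in complex_space) three_site_transfer:
  fixes A B C :: "'d::finite mat2" and x y z :: "'l::finite"
  assumes eq: "(site2 (*) (1::3) 2 A :: (3, 'd, complex) op) \<circ> site2 (*) 1 3 B \<circ> site2 (*) 2 3 C =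
      site2 (*) 2 3 C \<circ> site2 (*) 1 3 B \<circ> site2 (*) 1 2 A"
    and dist: "distinct [x, y, z]"
  shows "site2 sc x y A \<circ> site2 sc x z B \<circ> site2 sc y z C =
      site2 sc y z C \<circ> site2 sc x z B \<circ> site2 sc x y A"
proof -
  define f where "f = (\<lambda>i::3. if i = 1 then x else if i = 2 then y else z)"
  have inj: "inj f" unfolding f_def by (rule inj_3[OF dist])
  have f: "x = f 1" "y = f 2" "z = f 3" by (simp_all add: f_def)
  show ?thesis
    unfolding f
  proof (rule ext, rule glue_eqI[OF inj], rule ext, rule functionals_separate_points)
    fix \<psi> s t \<phi>
    assume lin: "Vector_Spaces.linear sc (*) \<phi>"
    note move = site2_glue_functional[OF inj lin]
    have l: "(\<lambda>t. \<phi> ((site2 sc (f 1) (f 2) A \<circ> site2 sc (f 1) (f 3) B \<circ> site2 sc (f 2) (f 3) C) \<psi> (glue f s t))) =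
      (site2 (*) (1::3) 2 A \<circ> site2 (*) 1 3 B \<circ> site2 (*) 2 3 C) (\<lambda>t. \<phi> (\<psi> (glue f s t)))"
      unfolding o_apply by (simp only: move)
    have r: "(\<lambda>t. \<phi> ((site2 sc (f 2) (f 3) C \<circ> site2 sc (f 1) (f 3) B \<circ> site2 sc (f 1) (f 2) A) \<psi> (glue f s t))) =
      (site2 (*) (2::3) 3 C \<circ> site2 (*) 1 3 B \<circ> site2 (*) 1 2 A) (\<lambda>t. \<phi> (\<psi> (glue f s t)))"
      unfolding o_apply by (simp only: move)
    show "\<phi> ((site2 sc (f 1) (f 2) A \<circ> site2 sc (f 1) (f 3) B \<circ> site2 sc (f 2) (f 3) C) \<psi> (glue f s t)) =
      \<phi> ((site2 sc (f 2) (f 3) C \<circ> site2 sc (f 1) (f 3) B \<circ> site2 sc (f 1) (f 2) A) \<psi> (glue f s t))"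
      by (rule fun_cong[OF trans[OF trans[OF l fun_cong[OF eq]] r[symmetric]], of t])
  qed
qed

text \<open>
  Here the vectors have values in the same quantum space at both places, so that restriction alone
  is enough.
\<close>

lemma two_site_transfer:
  fixes A B C F :: "'d::finite mat2" and x y :: "'l::finite"
    and sc :: "complex \<Rightarrow> 'h \<Rightarrow> 'h::ab_group_add"
  assumes eq: "(site2 sc (1::2) 2 A :: (2, 'd, 'h) op) \<circ> siteq 1 K1 \<circ> site1 sc 1 M' \<circ>
        site2 sc 2 1 B \<circ> site1 sc 1 M \<circ> siteq 2 K2 =
      siteq 2 K2 \<circ> site1 sc 1 M \<circ> site2 sc 1 2 C \<circ> site1 sc 1 M' \<circ> siteq 1 K1 \<circ> site2 sc 2 1 F"
    and "x \<noteq> y"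
  shows "site2 sc x y A \<circ> siteq x K1 \<circ> site1 sc x M' \<circ> site2 sc y x B \<circ> site1 sc x M \<circ> siteq y K2 =
      siteq y K2 \<circ> site1 sc x M \<circ> site2 sc x y C \<circ> site1 sc x M' \<circ> siteq x K1 \<circ> site2 sc y x F"
proof -
  define f where "f = (\<lambda>i::2. if i = 1 then x else y)"
  have inj: "inj f" unfolding f_def by (rule inj_2[OF \<open>x \<noteq> y\<close>])
  have f: "x = f 1" "y = f 2" by (simp_all add: f_def)
  note move = site2_glue[OF inj] site1_glue[OF inj] siteq_glue[OF inj]
  show ?thesis
    unfolding f
  proof (rule ext, rule glue_eqI[OF inj])
    fix \<psi> s
    show "(\<lambda>t. (site2 sc (f 1) (f 2) A \<circ> siteq (f 1) K1 \<circ> site1 sc (f 1) M' \<circ> site2 sc (f 2) (f 1) B \<circ>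
          site1 sc (f 1) M \<circ> siteq (f 2) K2) \<psi> (glue f s t)) =
        (\<lambda>t. (siteq (f 2) K2 \<circ> site1 sc (f 1) M \<circ> site2 sc (f 1) (f 2) C \<circ> site1 sc (f 1) M' \<circ>
          siteq (f 1) K1 \<circ> site2 sc (f 2) (f 1) F) \<psi> (glue f s t))"
      using fun_cong[OF eq, of "\<lambda>t. \<psi> (glue f s t)"] unfolding o_apply by (simp only: move)
  qed
qed

section \<open>Generic parameters\<close>

lemma closure_eq_UNIV_iff:
  "closure U = UNIV \<longleftrightarrow> (\<forall>W. open W \<longrightarrow> W \<noteq> {} \<longrightarrow> W \<inter> U \<noteq> {})"
proof (intro iffI allI impI)
  fix W :: "'a set"
  assume "closure U = UNIV" "open W" "W \<noteq> {}"
  then show "W \<inter> U \<noteq> {}" using open_Int_closure_eq_empty[of W U] by auto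
next
  assume *: "\<forall>W. open W \<longrightarrow> W \<noteq> {} \<longrightarrow> W \<inter> U \<noteq> {}"
  have "- closure U = {}"
    using *[rule_format, of "- closure U"] closure_subset[of U] by auto
  then show "closure U = UNIV" by auto
qed

lemma generic_True: "generic (\<lambda>_. True)"
  unfolding generic_def by (intro exI[of _ UNIV]) auto

lemma generic_mono: "generic P \<Longrightarrow> (\<And>x. P x \<Longrightarrow> Q x) \<Longrightarrow> generic Q"
  unfolding generic_def by blast

lemma generic_conj: "generic P \<Longrightarrow> generic Q \<Longrightarrow> generic (\<lambda>x. P x \<and> Q x)"
proof -
  assume "generic P" "generic Q"
  then obtain U U' where U: "open U" "closure U = UNIV" "\<forall>x\<in>U. P x"
    and U': "open U'" "closure U' = UNIV" "\<forall>x\<in>U'. Q x"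
    unfolding generic_def by blast
  have "closure (U \<inter> U') = UNIV"
    unfolding closure_eq_UNIV_iff
  proof (intro allI impI)
    fix W :: "'a set"
    assume "open W" "W \<noteq> {}"
    then have "open (W \<inter> U)" "W \<inter> U \<noteq> {}"
      using U by (auto simp: closure_eq_UNIV_iff)
    then have "(W \<inter> U) \<inter> U' \<noteq> {}"
      using U'(2) unfolding closure_eq_UNIV_iff by blast
    then show "W \<inter> (U \<inter> U') \<noteq> {}" by (simp add: Int_assoc)
  qed
  then show ?thesis
    unfolding generic_def using U U' by (intro exI[of _ "U \<inter> U'"]) auto
qed

lemma generic_all:
  assumes "\<And>i::'i::finite. generic (P i)"
  shows "generic (\<lambda>x. \<forall>i. P i x)"
proof -
  have "generic (\<lambda>x. \<forall>i\<in>I. P i x)" for I :: "'i set"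
    using finite[of I]
  proof (induction I)
    case (insert i I)
    then show ?case using generic_conj[OF assms[of i] insert.IH] by simp
  qed (simp add: generic_True)
  from this[of UNIV] show ?thesis by simp
qed

lemma generic_imp: "(c \<Longrightarrow> generic P) \<Longrightarrow> generic (\<lambda>x. c \<longrightarrow> P x)"
  by (cases c) (simp_all add: generic_True)

text \<open>
  Surjective linear maps are open. The image of a nonempty open set is therefore open and
  nonempty, and it meets the given dense set.
\<close>

lemma generic_affine_vimage:
  fixes g :: "'a::euclidean_space \<Rightarrow> 'b::euclidean_space"
  assumes "generic P" "linear g" "surj g"
  shows "generic (\<lambda>l. P (g l + c))"
proof -
  obtain U where U: "open U" "closure U = UNIV" "\<forall>x\<in>U. P x"
    using assms(1) unfolding generic_def by blast
  let ?h = "\<lambda>l. g l + c"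
  have "open (?h -` U)"
    by (intro open_vimage U continuous_intros linear_continuous_on linear_conv_bounded_linear[THEN iffD1] assms)
  moreover have "closure (?h -` U) = UNIV"
    unfolding closure_eq_UNIV_iff
  proof (intro allI impI)
    fix W :: "'a set"
    assume "open W" "W \<noteq> {}"
    have "open ((+) c ` g ` W)"
      by (intro open_translation open_surjective_linear_image assms \<open>open W\<close>)
    then have "(+) c ` g ` W \<inter> U \<noteq> {}"
      using U(2) \<open>W \<noteq> {}\<close> unfolding closure_eq_UNIV_iff by blast
    then show "W \<inter> ?h -` U \<noteq> {}" by (auto simp: add.commute)
  qed
  ultimately show ?thesis
    unfolding generic_def using U(3) by (intro exI[of _ "?h -` U"]) auto
qed

text \<open>
  The four kinds of arguments at which the hypotheses are evaluated. Each is a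
  surjective affine function of the parameters because the labels are different: as many of them as
  there are arguments can be prescribed independently.
\<close>

lemma generic_two_labels:
  fixes x y :: "'l::finite"
  assumes P: "generic (\<lambda>(a, b). P a b)" and "x \<noteq> y"
  shows "generic (\<lambda>l :: complex ^ 'l. P (l $ x) (l $ y))"
proof -
  let ?g = "\<lambda>l :: complex ^ 'l. (l $ x, l $ y)"
  have "surj ?g"
  proof (intro surjI)
    fix p :: "complex \<times> complex"
    show "?g (\<chi> i. if i = x then fst p else snd p) = p" using \<open>x \<noteq> y\<close> by (auto simp: prod_eq_iff)
  qed
  moreover have "linear ?g" by (intro linearI) auto
  ultimately show ?thesis using generic_affine_vimage[OF P, of ?g 0] by simp
qed

lemma generic_sum_labels:
  fixes x y :: "'l::finite"
  assumes P: "generic P" and "x \<noteq> y"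
  shows "generic (\<lambda>l :: complex ^ 'l. P (- (l $ x) - l $ y - c))"
proof -
  let ?g = "\<lambda>l :: complex ^ 'l. - (l $ x) - l $ y"
  have "surj ?g"
  proof (intro surjI)
    fix p :: complex
    show "?g (\<chi> i. if i = x then - p else 0) = p" using \<open>x \<noteq> y\<close> by auto
  qed
  moreover have "linear ?g" by (intro linearI) (auto simp: scaleR_right_diff_distrib)
  ultimately show ?thesis using generic_affine_vimage[OF P, of ?g "- c"] by simp
qed

lemma generic_sums_above:
  fixes x y z :: "'l::finite"
  assumes P: "generic (\<lambda>(a, b). P a b)" and "distinct [x, y, z]"
  shows "generic (\<lambda>l :: complex ^ 'l. P (- (l $ x) - l $ z - c) (- (l $ y) - l $ z - c))"
proof -
  let ?g = "\<lambda>l :: complex ^ 'l. (- (l $ x) - l $ z, - (l $ y) - l $ z)"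
  have "surj ?g"
  proof (intro surjI)
    fix p :: "complex \<times> complex"
    show "?g (\<chi> i. if i = x then - fst p else if i = y then - snd p else 0) = p"
      using assms(2) by (auto simp: prod_eq_iff)
  qed
  moreover have "linear ?g" by (intro linearI) (auto simp: scaleR_right_diff_distrib)
  ultimately show ?thesis using generic_affine_vimage[OF P, of ?g "(- c, - c)"] by simp
qed

lemma generic_sum_difference:
  fixes x y z :: "'l::finite"
  assumes P: "generic (\<lambda>(a, b). P a b)" and "distinct [x, y, z]"
  shows "generic (\<lambda>l :: complex ^ 'l. P (- (l $ x) - l $ z - c) (l $ y - l $ z))"
proof -
  let ?g = "\<lambda>l :: complex ^ 'l. (- (l $ x) - l $ z, l $ y - l $ z)"
  have "surj ?g"
  proof (intro surjI)
    fix p :: "complex \<times> complex"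
    show "?g (\<chi> i. if i = x then - fst p else if i = y then snd p else 0) = p"
      using assms(2) by (auto simp: prod_eq_iff)
  qed
  moreover have "linear ?g" by (intro linearI) (auto simp: scaleR_right_diff_distrib)
  ultimately show ?thesis using generic_affine_vimage[OF P, of ?g "(- c, 0)"] by simp
qed

section \<open>Conjugation by products of one-site matrices\<close>

lemma oprod_conjugate:
  assumes "S' \<circ> S = id" "S \<circ> S' = id"
  shows "S \<circ> oprod fs \<circ> S' = oprod (map (\<lambda>f. S \<circ> f \<circ> S') fs)"
proof (induction fs)
  case Nil
  then show ?case using assms by simp
next
  case (Cons f fs)
  have "S \<circ> oprod (f # fs) \<circ> S' = S \<circ> f \<circ> id \<circ> oprod fs \<circ> S'"
    by (simp add: o_assoc)
  also have "\<dots> = (S \<circ> f \<circ> S') \<circ> (S \<circ> oprod fs \<circ> S')"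
    unfolding assms(1)[symmetric] by (simp add: o_assoc)
  finally show ?case unfolding Cons.IH oprod_simps list.map .
qed

lemma fused_conjugate:
  assumes "S' \<circ> S = id" "S \<circ> S' = id"
    and "\<And>x y. x \<in> set X \<Longrightarrow> y \<in> set Y \<Longrightarrow> S \<circ> site2 sc x y (F x y) \<circ> S' = site2 sc x y (G x y)"
  shows "S \<circ> fused sc F X Y \<circ> S' = fused sc G X Y"
  unfolding fused_def oprod_conjugate[OF assms(1,2)]
  using assms(3) by (auto simp: map_concat comp_def intro!: arg_cong[where f = oprod] arg_cong[where f = concat])

text \<open>
  In the application, \<open>Q\<close> and \<open>T\<close> share the site on which \<open>S\<close> acts, while \<open>P\<close> does not act there.
  The adjacent factors \<open>S\<close> and \<open>S'\<close> cancel, and the outer ones move past \<open>P\<close>.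
\<close>

lemma exchange_conjugate:
  assumes PQT: "P \<circ> Q \<circ> T = T \<circ> Q \<circ> P"
    and S: "S \<circ> S' = id" and comm: "P \<circ> S = S \<circ> P" "P \<circ> S' = S' \<circ> P"
  shows "P \<circ> (S' \<circ> Q \<circ> S) \<circ> (S' \<circ> T \<circ> S) = (S' \<circ> T \<circ> S) \<circ> (S' \<circ> Q \<circ> S) \<circ> P"
proof -
  have S1: "S (S' \<psi>) = \<psi>" for \<psi> using fun_cong[OF S] by simp
  have P1: "P (S \<psi>) = S (P \<psi>)" "P (S' \<psi>) = S' (P \<psi>)" for \<psi>
    using fun_cong[OF comm(1)] fun_cong[OF comm(2)] by simp_all
  have "P (Q (T \<psi>)) = T (Q (P \<psi>))" for \<psi> using fun_cong[OF PQT] by simp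
  then show ?thesis by (intro ext) (simp add: S1 P1)
qed

lemma siteM_simps [simp]: "siteM sc M [] = id" "siteM sc M (x # X) = site1 sc x M \<circ> siteM sc M X"
  by (simp_all add: siteM_def)

context complex_space
begin

lemma site1_siteM_commute:
  "x \<notin> set X \<Longrightarrow> site1 sc x A \<circ> siteM sc B X = siteM sc B X \<circ> site1 sc x A"
  unfolding siteM_def by (intro oprod_commute) (auto intro!: site1_site1_commute)

lemma site2_siteM_commute:
  "x \<notin> set X \<Longrightarrow> y \<notin> set X \<Longrightarrow> site2 sc x y A \<circ> siteM sc B X = siteM sc B X \<circ> site2 sc x y A"
  unfolding siteM_def by (intro oprod_commute) (auto intro!: site1_site2_commute[symmetric])

lemma siteM_inverse:
  assumes "A ** B = mat 1" "distinct X"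
  shows "siteM sc A X \<circ> siteM sc B X = id"
  using assms(2)
proof (induction X)
  case (Cons x X)
  have "siteM sc A (x # X) \<circ> siteM sc B (x # X) =
      site1 sc x A \<circ> (siteM sc A X \<circ> site1 sc x B) \<circ> siteM sc B X"
    by (simp add: o_assoc)
  also have "siteM sc A X \<circ> site1 sc x B = site1 sc x B \<circ> siteM sc A X"
    using Cons.prems by (intro site1_siteM_commute[symmetric]) auto
  also have "site1 sc x A \<circ> (site1 sc x B \<circ> siteM sc A X) \<circ> siteM sc B X =
      (site1 sc x A \<circ> site1 sc x B) \<circ> (siteM sc A X \<circ> siteM sc B X)"
    by (simp add: o_assoc)
  also have "siteM sc A X \<circ> siteM sc B X = id"
    using Cons.prems by (intro Cons.IH) simp
  also have "site1 sc x A \<circ> site1 sc x B \<circ> id = id"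
    by (simp only: site1_inverse[OF assms(1)] comp_id)
  finally show ?case .
qed simp

text \<open>
  The one-site matrices at labels other than \<open>z\<close> commute with everything between them and their
  inverses and cancel.
\<close>

lemma siteM_conjugate_site2:
  assumes AB: "A ** B = mat 1" and "distinct X" "z \<in> set X" "w \<notin> set X" "{x, y} = {z, w}"
  shows "siteM sc A X \<circ> site2 sc x y C \<circ> siteM sc B X = site1 sc z A \<circ> site2 sc x y C \<circ> site1 sc z B"
  using assms(2-4)
proof (induction X)
  case (Cons m X)
  have B1: "siteM sc A X (site1 sc m B \<psi>) = site1 sc m B (siteM sc A X \<psi>)" for \<psi>
    using fun_cong[OF site1_siteM_commute[of m X B A]] Cons.prems by simp
  show ?case
  proof (cases "m = z")
    case True
    have "x \<notin> set X" "y \<notin> set X" using Cons.prems True assms(5) by (auto simp: doubleton_eq_iff)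
    then have C1: "siteM sc A X (site2 sc x y C \<psi>) = site2 sc x y C (siteM sc A X \<psi>)" for \<psi>
      using fun_cong[OF site2_siteM_commute[of x X y C A]] by simp
    have "siteM sc A X (siteM sc B X \<psi>) = \<psi>" for \<psi>
      using fun_cong[OF siteM_inverse[OF AB, of X]] Cons.prems by simp
    then show ?thesis unfolding True[symmetric] by (intro ext) (simp add: B1 C1)
  next
    case False
    then have "m \<notin> {x, y}" using Cons.prems assms(5) by (auto simp: doubleton_eq_iff)
    then have C1: "site2 sc x y C (site1 sc m B \<psi>) = site1 sc m B (site2 sc x y C \<psi>)" for \<psi>
      using fun_cong[OF site1_site2_commute[of m x y B C]] by simp
    have m1: "site1 sc m A (site1 sc m B \<psi>) = \<psi>" for \<psi>
      using fun_cong[OF site1_inverse[OF AB, of m]] by simp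
    have IH: "siteM sc A X \<circ> site2 sc x y C \<circ> siteM sc B X = site1 sc z A \<circ> site2 sc x y C \<circ> site1 sc z B"
      using Cons.prems False by (intro Cons.IH) auto
    have "siteM sc A X (site2 sc x y C (siteM sc B X \<psi>)) = site1 sc z A (site2 sc x y C (site1 sc z B \<psi>))" for \<psi>
      using fun_cong[OF IH] by simp
    then show ?thesis by (intro ext) (simp add: B1 C1 m1)
  qed
qed simp

end

section \<open>The exchange relations at a single good parameter\<close>

lemma fused_singleton_left: "fused sc F [x] Y = oprod (map (\<lambda>y. site2 sc x y (F x y)) Y)"
  by (induction Y) (simp_all add: fused_def)

lemma fusedR_eq_fused: "fusedR sc R u X Y = fused sc (\<lambda>x y. R (u x y)) X Y"
  by (simp add: fusedR_def fused_def)

text \<open>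
  The parameters \<open>l\<close> at which every instance of the hypotheses that the argument uses is valid. In
  \<open>RRR_above\<close> the arguments of the Yang--Baxter equation are \<open>\<lambda>\<^sub>1 = - l\<^sub>x - l\<^sub>z - 2\<rho>\<close> and
  \<open>\<lambda>\<^sub>2 = - l\<^sub>y - l\<^sub>z - 2\<rho>\<close>; in \<open>RRR_below\<close> the second one is \<open>\<lambda>\<^sub>2 = l\<^sub>y - l\<^sub>z\<close>. These choices make the
  difference \<open>\<lambda>\<^sub>1 - \<lambda>\<^sub>2\<close> again a difference or a shifted negative sum of two parameters.
\<close>

locale good_parameters = complex_space sc
  for sc :: "complex \<Rightarrow> 'h \<Rightarrow> 'h::ab_group_add" +
  fixes R :: "complex \<Rightarrow> 'd::finite mat2"
    and M :: "'d mat1"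
    and \<rho> :: complex
    and K :: "complex \<Rightarrow> ('h \<Rightarrow> 'h) ^ 'd ^ 'd"
    and l :: "complex ^ 'l::finite"
  assumes invertible_M: "invertible M"
    and linear_K: "\<And>u a b. Vector_Spaces.linear sc sc (K u $ a $ b)"
    and RRR_above: "\<And>x y z. distinct [x, y, z] \<Longrightarrow>
      site2 sc x y (R (l $ y - l $ x)) \<circ> site2 sc x z (R (- (l $ x) - l $ z - 2 * \<rho>)) \<circ>
        site2 sc y z (R (- (l $ y) - l $ z - 2 * \<rho>)) =
      site2 sc y z (R (- (l $ y) - l $ z - 2 * \<rho>)) \<circ> site2 sc x z (R (- (l $ x) - l $ z - 2 * \<rho>)) \<circ>
        site2 sc x y (R (l $ y - l $ x))"
    and RRR_below: "\<And>x y z. distinct [x, y, z] \<Longrightarrow>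
      site2 sc x y (R (- (l $ x) - l $ y - 2 * \<rho>)) \<circ> site2 sc x z (R (- (l $ x) - l $ z - 2 * \<rho>)) \<circ>
        site2 sc y z (R (l $ y - l $ z)) =
      site2 sc y z (R (l $ y - l $ z)) \<circ> site2 sc x z (R (- (l $ x) - l $ z - 2 * \<rho>)) \<circ>
        site2 sc x y (R (- (l $ x) - l $ y - 2 * \<rho>))"
    and R_MM: "\<And>x y. x \<noteq> y \<Longrightarrow>
      R (- (l $ x) - l $ y - 2 * \<rho>) ** tensor M M = tensor M M ** R (- (l $ x) - l $ y - 2 * \<rho>)"
    and reflection: "\<And>x y. x \<noteq> y \<Longrightarrow>
      site2 sc x y (R (- (l $ x) + l $ y)) \<circ> siteq x (K (l $ x)) \<circ> site1 sc x (matrix_inv M) \<circ>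
        site2 sc y x (R (- (l $ x) - l $ y - 2 * \<rho>)) \<circ> site1 sc x M \<circ> siteq y (K (l $ y)) =
      siteq y (K (l $ y)) \<circ> site1 sc x M \<circ> site2 sc x y (R (- (l $ x) - l $ y - 2 * \<rho>)) \<circ>
        site1 sc x (matrix_inv M) \<circ> siteq x (K (l $ x)) \<circ> site2 sc y x (R (- (l $ x) + l $ y))"
begin

definition conj_R :: "'l \<Rightarrow> 'l \<Rightarrow> 'd mat2" where
  "conj_R x y = tensor M (mat 1) ** R (- (l $ x) - l $ y - 2 * \<rho>) ** tensor (matrix_inv M) (mat 1)"

lemma M_inv: "M ** matrix_inv M = mat 1" "matrix_inv M ** M = mat 1"
  using someI_ex[OF invertible_M[unfolded invertible_def]] unfolding matrix_inv_def by auto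

lemma conj_R_left:
  assumes "x \<noteq> y"
  shows "site1 sc x M \<circ> site2 sc x y (R (- (l $ x) - l $ y - 2 * \<rho>)) \<circ> site1 sc x (matrix_inv M) =
    site2 sc x y (conj_R x y)"
  using assms by (simp add: conj_R_def site1_eq_site2_left[OF assms] site2_mult)

lemma conj_R_right:
  assumes "x \<noteq> y"
  shows "site1 sc y (matrix_inv M) \<circ> site2 sc x y (R (- (l $ x) - l $ y - 2 * \<rho>)) \<circ> site1 sc y M =
    site2 sc x y (conj_R x y)"
  unfolding conj_R_def tensor_conj_swap[OF R_MM[OF assms] M_inv]
  using assms by (simp add: site1_eq_site2_right[OF assms] site2_mult)

text \<open>
  Both Yang--Baxter relations are conjugated at the site common to both \<open>A\<close>'s: at \<open>z\<close> for the first and at \<open>x\<close> for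
  the second. In the reflection equation both conjugations are by \<open>M\<close> at \<open>x\<close>, and they act in the
  first factor of \<open>A\<^sub>x\<^sub>y\<close> but in the second factor of \<open>A\<^sub>y\<^sub>x\<close>; the two descriptions of \<open>conj_R\<close>
  account for this.
\<close>

lemma exchange_relations:
  "exchange_relations sc conj_R (\<lambda>x y. R (l $ y - l $ x)) (\<lambda>x y. R (l $ x - l $ y)) (\<lambda>x. K (l $ x))"
proof (intro exchange_relations.intro[OF complex_space_axioms] exchange_relations_axioms.intro)
  fix x a b
  show "Vector_Spaces.linear sc sc (K (l $ x) $ a $ b)" by (rule linear_K)
next
  fix x y z :: 'l
  assume d: "distinct [x, y, z]"
  then have n: "x \<noteq> y" "x \<noteq> z" "y \<noteq> z" by auto
  show "site2 sc x y (R (l $ y - l $ x)) \<circ> site2 sc x z (conj_R x z) \<circ> site2 sc y z (conj_R y z) =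
      site2 sc y z (conj_R y z) \<circ> site2 sc x z (conj_R x z) \<circ> site2 sc x y (R (l $ y - l $ x))"
    unfolding conj_R_right[OF n(2), symmetric] conj_R_right[OF n(3), symmetric]
    using n by (intro exchange_conjugate RRR_above d site1_inverse M_inv site1_site2_commute[symmetric]) auto
  show "site2 sc x y (conj_R x y) \<circ> site2 sc x z (conj_R x z) \<circ> site2 sc y z (R (l $ y - l $ z)) =
      site2 sc y z (R (l $ y - l $ z)) \<circ> site2 sc x z (conj_R x z) \<circ> site2 sc x y (conj_R x y)"
    unfolding conj_R_left[OF n(1), symmetric] conj_R_left[OF n(2), symmetric]
    using n by (intro exchange_conjugate[symmetric] RRR_below[symmetric] d site1_inverse M_inv
        site1_site2_commute[symmetric]) auto
next
  fix x y :: 'l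
  assume n: "x \<noteq> y"
  have s: "- (l $ x) + l $ y = l $ y - l $ x" "- (l $ x) - l $ y - 2 * \<rho> = - (l $ y) - l $ x - 2 * \<rho>" by simp_all
  show "site2 sc x y (R (l $ y - l $ x)) \<circ> siteq x (K (l $ x)) \<circ> site2 sc y x (conj_R y x) \<circ> siteq y (K (l $ y)) =
      siteq y (K (l $ y)) \<circ> site2 sc x y (conj_R x y) \<circ> siteq x (K (l $ x)) \<circ> site2 sc y x (R (l $ y - l $ x))"
    unfolding conj_R_left[OF n, symmetric] conj_R_right[OF n[symmetric], symmetric]
    using reflection[OF n] unfolding s(1) by (simp only: o_assoc s(2))
qed

lemma K0_eq_dressed:
  "distinct X \<Longrightarrow> K0 sc R M \<rho> K l X = dressed sc conj_R (\<lambda>x. K (l $ x)) X"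
proof (induction X rule: induct_list012)
  case (3 x y ys)
  let ?F = "fused sc (\<lambda>x z. R (- (l $ x) - l $ z - 2 * \<rho>)) [x] (rev (y # ys))"
  have conj: "site1 sc x M \<circ> ?F \<circ> site1 sc x (matrix_inv M) = fused sc conj_R [x] (rev (y # ys))"
    using 3 by (intro fused_conjugate site1_inverse M_inv) (auto intro!: conj_R_left)
  have IH: "K0 sc R M \<rho> K l (y # ys) = dressed sc conj_R (\<lambda>x. K (l $ x)) (y # ys)"
    using 3 by (intro "3.IH") auto
  have "K0 sc R M \<rho> K l (x # y # ys) = K0 sc R M \<rho> K l (y # ys) \<circ>
      (site1 sc x M \<circ> ?F \<circ> site1 sc x (matrix_inv M)) \<circ> siteq x (K (l $ x))"
    by (simp only: K0.simps fused_singleton_left comp_assoc)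
  then show ?case
    unfolding conj IH by (simp only: dressed.simps(2)[of _ _ _ x])
qed simp_all

lemma siteM_inv_pair:
  assumes "distinct X"
  shows "siteM sc (matrix_inv M) X \<circ> siteM sc M X = id" "siteM sc M X \<circ> siteM sc (matrix_inv M) X = id"
  using siteM_inverse M_inv assms by blast+

lemma inv_siteM: "distinct X \<Longrightarrow> inv (siteM sc M X) = siteM sc (matrix_inv M) X"
  by (intro inv_unique_comp siteM_inv_pair)

text \<open>
  The labels in \<open>X\<close> are the first ones of each factor here and the second ones in
  \<open>fusedR_conj_right\<close>, where \<open>M\<close> and its inverse change places. The conjugated factors are the
  same in both cases.
\<close>

lemma fusedR_conj_left:
  assumes "distinct X" "set X \<inter> set Y = {}"
  shows "siteM sc M X \<circ> fusedR sc R (\<lambda>x y. - (l $ y) - l $ x - 2 * \<rho>) (rev X) (rev Y) \<circ> inv (siteM sc M X) =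
    fused sc conj_R (rev X) (rev Y)"
  unfolding inv_siteM[OF assms(1)] fusedR_eq_fused
proof (intro fused_conjugate siteM_inv_pair assms(1))
  fix x y assume "x \<in> set (rev X)" "y \<in> set (rev Y)"
  then have xy: "x \<in> set X" "y \<notin> set X" "x \<noteq> y" using assms by auto
  have s: "- (l $ y) - l $ x - 2 * \<rho> = - (l $ x) - l $ y - 2 * \<rho>" by simp
  show "siteM sc M X \<circ> site2 sc x y (R (- (l $ y) - l $ x - 2 * \<rho>)) \<circ> siteM sc (matrix_inv M) X =
      site2 sc x y (conj_R x y)"
    unfolding siteM_conjugate_site2[OF M_inv(1) assms(1) xy(1,2) refl] s by (rule conj_R_left[OF xy(3)])
qed

lemma fusedR_conj_right:
  assumes "distinct X" "set X \<inter> set Y = {}"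
  shows "inv (siteM sc M X) \<circ> fusedR sc R (\<lambda>x y. - (l $ x) - l $ y - 2 * \<rho>) (rev Y) (rev X) \<circ> siteM sc M X =
    fused sc conj_R (rev Y) (rev X)"
  unfolding inv_siteM[OF assms(1)] fusedR_eq_fused
proof (intro fused_conjugate siteM_inv_pair assms(1))
  fix x y assume "x \<in> set (rev Y)" "y \<in> set (rev X)"
  then have xy: "y \<in> set X" "x \<notin> set X" "x \<noteq> y" using assms by auto
  show "siteM sc (matrix_inv M) X \<circ> site2 sc x y (R (- (l $ x) - l $ y - 2 * \<rho>)) \<circ> siteM sc M X =
      site2 sc x y (conj_R x y)"
    unfolding siteM_conjugate_site2[OF M_inv(2) assms(1) xy(1,2) insert_commute] by (rule conj_R_right[OF xy(3)])
qed

lemma generalized_dual_reflection: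
  assumes "distinct (N @ P)"
  shows "K0 sc R M \<rho> K l N \<circ>
    siteM sc M P \<circ> fusedR sc R (\<lambda>x y. - (l $ y) - l $ x - 2 * \<rho>) (rev P) (rev N) \<circ> inv (siteM sc M P) \<circ>
    K0 sc R M \<rho> K l P \<circ>
    fusedR sc R (\<lambda>x y. l $ x - l $ y) N (rev P)
    =
    fusedR sc R (\<lambda>x y. l $ y - l $ x) (rev P) N \<circ>
    K0 sc R M \<rho> K l P \<circ>
    inv (siteM sc M P) \<circ> fusedR sc R (\<lambda>x y. - (l $ x) - l $ y - 2 * \<rho>) (rev N) (rev P) \<circ> siteM sc M P \<circ>
    K0 sc R M \<rho> K l N" (is "?K \<circ> ?S \<circ> ?R \<circ> ?S' \<circ> ?K' \<circ> ?E = ?D \<circ> _ \<circ> _ \<circ> ?R' \<circ> _ \<circ> _")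
proof -
  have d: "distinct N" "distinct P" "set P \<inter> set N = {}" using assms by auto
  have "?K \<circ> ?S \<circ> ?R \<circ> ?S' \<circ> ?K' \<circ> ?E = ?K \<circ> (?S \<circ> ?R \<circ> ?S') \<circ> ?K' \<circ> ?E"
    by (simp only: comp_assoc)
  also have "\<dots> = dressed sc conj_R (\<lambda>x. K (l $ x)) N \<circ> fused sc conj_R (rev P) (rev N) \<circ> dressed sc conj_R (\<lambda>x. K (l $ x)) P \<circ> fused sc (\<lambda>x y. R (l $ x - l $ y)) N (rev P)"
    unfolding fusedR_conj_left[OF d(2,3)] K0_eq_dressed[OF d(1)] K0_eq_dressed[OF d(2)] by (simp only: fusedR_eq_fused)
  also have "\<dots> = fused sc (\<lambda>x y. R (l $ y - l $ x)) (rev P) N \<circ> dressed sc conj_R (\<lambda>x. K (l $ x)) P \<circ> fused sc conj_R (rev N) (rev P) \<circ> dressed sc conj_R (\<lambda>x. K (l $ x)) N"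
    by (intro ext) (simp only: o_apply exchange_relations.generalized_reflection[OF exchange_relations assms])
  also have "\<dots> = ?D \<circ> ?K' \<circ> (?S' \<circ> ?R' \<circ> ?S) \<circ> ?K"
    unfolding fusedR_conj_right[OF d(2,3)] K0_eq_dressed[OF d(1)] K0_eq_dressed[OF d(2)] by (simp only: fusedR_eq_fused)
  also have "\<dots> = ?D \<circ> ?K' \<circ> ?S' \<circ> ?R' \<circ> ?S \<circ> ?K"
    by (simp only: comp_assoc)
  finally show ?thesis .
qed

end

section \<open>The generalized dual reflection equation\<close>

text \<open>
  There are finitely many tuples of labels, hence finitely many conditions on \<open>l\<close>.
\<close>

lemma generic_good_parameters:
  fixes sc :: "complex \<Rightarrow> 'h \<Rightarrow> 'h::ab_group_add" and R :: "complex \<Rightarrow> 'd::finite mat2"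
  assumes "vector_space sc"
    and lin: "\<And>u a b. Vector_Spaces.linear sc sc (K u $ a $ b)"
    and inv: "invertible M"
    and yb: "yang_baxter R" and mm: "commutes_MM R M" and dr: "dual_reflection sc R M \<rho> K"
  shows "generic (\<lambda>l :: complex ^ 'l::finite. good_parameters sc R M \<rho> K l)"
proof -
  interpret complex_space sc by (rule complex_space.intro) fact
  let ?Y = "\<lambda>l1 l2. (site2 (*) (1::3) 2 (R (l1 - l2)) :: (3, 'd, complex) op) \<circ> site2 (*) 1 3 (R l1) \<circ> site2 (*) 2 3 (R l2) =
      site2 (*) 2 3 (R l2) \<circ> site2 (*) 1 3 (R l1) \<circ> site2 (*) 1 2 (R (l1 - l2))"
  let ?Q = "\<lambda>l1 l2. (site2 sc (1::2) 2 (R (- l1 + l2)) :: (2, 'd, 'h) op) \<circ> siteq 1 (K l1) \<circ> site1 sc 1 (matrix_inv M) \<circ>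
        site2 sc 2 1 (R (- l1 - l2 - 2 * \<rho>)) \<circ> site1 sc 1 M \<circ> siteq 2 (K l2) =
      siteq 2 (K l2) \<circ> site1 sc 1 M \<circ> site2 sc 1 2 (R (- l1 - l2 - 2 * \<rho>)) \<circ> site1 sc 1 (matrix_inv M) \<circ>
        siteq 1 (K l1) \<circ> site2 sc 2 1 (R (- l1 + l2))"
  let ?C = "\<lambda>u. R u ** tensor M M = tensor M M ** R u"
  have Y: "generic (\<lambda>(l1, l2). ?Y l1 l2)" using yb unfolding yang_baxter_def Let_def .
  have Q: "generic (\<lambda>(l1, l2). ?Q l1 l2)" using dr unfolding dual_reflection_def Let_def .
  have C: "generic ?C" using mm unfolding commutes_MM_def .
  have "generic (\<lambda>l :: complex ^ 'l.
     (\<forall>x y z. distinct [x, y, z] \<longrightarrow> ?Y (- (l $ x) - l $ z - 2 * \<rho>) (- (l $ y) - l $ z - 2 * \<rho>)) \<and>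
     (\<forall>x y z. distinct [x, y, z] \<longrightarrow> ?Y (- (l $ x) - l $ z - 2 * \<rho>) (l $ y - l $ z)) \<and>
     (\<forall>x y. x \<noteq> y \<longrightarrow> ?C (- (l $ x) - l $ y - 2 * \<rho>)) \<and>
     (\<forall>x y. x \<noteq> y \<longrightarrow> ?Q (l $ x) (l $ y)))"
  proof (intro generic_conj generic_all generic_imp)
    show "generic (\<lambda>l :: complex ^ 'l. ?Y (- (l $ x) - l $ z - 2 * \<rho>) (- (l $ y) - l $ z - 2 * \<rho>))"
      if "distinct [x, y, z]" for x y z
      by (rule generic_sums_above[OF Y that])
    show "generic (\<lambda>l :: complex ^ 'l. ?Y (- (l $ x) - l $ z - 2 * \<rho>) (l $ y - l $ z))"
      if "distinct [x, y, z]" for x y z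
      by (rule generic_sum_difference[OF Y that])
    show "generic (\<lambda>l :: complex ^ 'l. ?C (- (l $ x) - l $ y - 2 * \<rho>))" if "x \<noteq> y" for x y
      by (rule generic_sum_labels[OF C that])
    show "generic (\<lambda>l :: complex ^ 'l. ?Q (l $ x) (l $ y))" if "x \<noteq> y" for x y
      by (rule generic_two_labels[OF Q that])
  qed
  then show ?thesis
  proof (rule generic_mono, elim conjE,
      intro good_parameters.intro[OF complex_space_axioms] good_parameters_axioms.intro)
    fix l :: "complex ^ 'l"
    assume Y1: "\<forall>x y z. distinct [x, y, z] \<longrightarrow> ?Y (- (l $ x) - l $ z - 2 * \<rho>) (- (l $ y) - l $ z - 2 * \<rho>)"
      and Y2: "\<forall>x y z. distinct [x, y, z] \<longrightarrow> ?Y (- (l $ x) - l $ z - 2 * \<rho>) (l $ y - l $ z)"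
      and Cl: "\<forall>x y. x \<noteq> y \<longrightarrow> ?C (- (l $ x) - l $ y - 2 * \<rho>)"
      and Ql: "\<forall>x y. x \<noteq> y \<longrightarrow> ?Q (l $ x) (l $ y)"
    show "invertible M" by (rule inv)
    show "Vector_Spaces.linear sc sc (K u $ a $ b)" for u a b by (rule lin)
    show "?C (- (l $ x) - l $ y - 2 * \<rho>)" if "x \<noteq> y" for x y using Cl that by blast
    show "site2 sc x y (R (- (l $ x) + l $ y)) \<circ> siteq x (K (l $ x)) \<circ> site1 sc x (matrix_inv M) \<circ>
        site2 sc y x (R (- (l $ x) - l $ y - 2 * \<rho>)) \<circ> site1 sc x M \<circ> siteq y (K (l $ y)) =
      siteq y (K (l $ y)) \<circ> site1 sc x M \<circ> site2 sc x y (R (- (l $ x) - l $ y - 2 * \<rho>)) \<circ>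
        site1 sc x (matrix_inv M) \<circ> siteq x (K (l $ x)) \<circ> site2 sc y x (R (- (l $ x) + l $ y))"
      if "x \<noteq> y" for x y
      by (rule two_site_transfer[OF Ql[rule_format, OF that] that])
    fix x y z :: 'l
    assume d: "distinct [x, y, z]"
    have e1: "- (l $ x) - l $ z - 2 * \<rho> - (- (l $ y) - l $ z - 2 * \<rho>) = l $ y - l $ x"
      and e2: "- (l $ x) - l $ z - 2 * \<rho> - (l $ y - l $ z) = - (l $ x) - l $ y - 2 * \<rho>" by simp_all
    show "site2 sc x y (R (l $ y - l $ x)) \<circ> site2 sc x z (R (- (l $ x) - l $ z - 2 * \<rho>)) \<circ>
        site2 sc y z (R (- (l $ y) - l $ z - 2 * \<rho>)) =
      site2 sc y z (R (- (l $ y) - l $ z - 2 * \<rho>)) \<circ> site2 sc x z (R (- (l $ x) - l $ z - 2 * \<rho>)) \<circ>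
        site2 sc x y (R (l $ y - l $ x))"
      by (rule three_site_transfer[OF Y1[rule_format, OF d, unfolded e1] d])
    show "site2 sc x y (R (- (l $ x) - l $ y - 2 * \<rho>)) \<circ> site2 sc x z (R (- (l $ x) - l $ z - 2 * \<rho>)) \<circ>
        site2 sc y z (R (l $ y - l $ z)) =
      site2 sc y z (R (l $ y - l $ z)) \<circ> site2 sc x z (R (- (l $ x) - l $ z - 2 * \<rho>)) \<circ>
        site2 sc x y (R (- (l $ x) - l $ y - 2 * \<rho>))"
      by (rule three_site_transfer[OF Y2[rule_format, OF d, unfolded e2] d])
  qed
qed

theorem lemma2:
  fixes R :: "complex \<Rightarrow> 'd::finite mat2"
    and V M :: "'d mat1"
    and \<rho> :: complex
    and sc :: "complex \<Rightarrow> 'h \<Rightarrow> 'h::ab_group_add"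
    and K :: "complex \<Rightarrow> ('h \<Rightarrow> 'h) ^ 'd ^ 'd"
    and N M' :: "'l::finite list"
  assumes "yang_baxter R"
    and "pt_symmetric R"
    and "unitarity R"
    and "V ** V = mat 1"
    and "crossing R V \<rho>"
    and "M = transpose V ** V"
    and "crossing_unitarity R M \<rho>"
    and "commutes_MM R M"
    and "vector_space sc"
    and "\<And>u a b. Vector_Spaces.linear sc sc (K u $ a $ b)"
    and "dual_reflection sc R M \<rho> K"
    and "distinct (N @ M')" and "N \<noteq> []" and "M' \<noteq> []"
  shows "generic (\<lambda>l :: complex ^ 'l.
    K0 sc R M \<rho> K l N \<circ>
    siteM sc M M' \<circ> fusedR sc R (\<lambda>x y. - (l $ y) - l $ x - 2 * \<rho>) (rev M') (rev N) \<circ> inv (siteM sc M M') \<circ>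
    K0 sc R M \<rho> K l M' \<circ>
    fusedR sc R (\<lambda>x y. l $ x - l $ y) N (rev M')
    =
    fusedR sc R (\<lambda>x y. l $ y - l $ x) (rev M') N \<circ>
    K0 sc R M \<rho> K l M' \<circ>
    inv (siteM sc M M') \<circ> fusedR sc R (\<lambda>x y. - (l $ x) - l $ y - 2 * \<rho>) (rev N) (rev M') \<circ> siteM sc M M' \<circ>
    K0 sc R M \<rho> K l N)"
proof -
  \<comment> \<open>\<open>M\<close> is invertible since \<open>V\<close> is an involution.\<close>
  have "invertible V"
    using \<open>V ** V = mat 1\<close> unfolding invertible_def by blast
  moreover have "invertible (transpose V)"
    unfolding invertible_def using arg_cong[OF \<open>V ** V = mat 1\<close>, of transpose]
    by (intro exI[of _ "transpose V"]) (simp add: matrix_transpose_mul)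
  ultimately have "invertible M"
    unfolding \<open>M = transpose V ** V\<close> by (intro invertible_mult)
  then have "generic (\<lambda>l :: complex ^ 'l. good_parameters sc R M \<rho> K l)"
    by (intro generic_good_parameters assms)
  then show ?thesis
    by (rule generic_mono) (rule good_parameters.generalized_dual_reflection[OF _ \<open>distinct (N @ M')\<close>])
qed

end
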